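(* Let $n\geq 1$. There exists a bijection between the following two sets: (S1) the set of pairs $(M,\prec)$, where $M$ is a non-oriented map with $n$ edges and exactly one face, and $\prec$ is a linear order on the set of edges of $M$ such that for each $1\le i<n$, the ribbon graph obtained from the ribbon graph of $M$ by removing the first $i$ edges (according to $\prec$) has the same number of connected components as the number of its faces; (S2) the set of pairs $(M,\prec)$, where $M$ is an oriented map with $n$ edges and an arbitrary number of faces, and $\prec$ is an arbitrary linear order on the set of edges of $M$.
   Context: A map is a graph drawn on a surface (so that the faces are discs). All maps considered are bicolored (bipartite with a specified partition of the vertices into white and black vertices), connected, rooted (one edge is distinguished) and unlabeled (counted up to isomorphism). A map is oriented if the surface is orientable and equipped with a chosen orientation; it is non-oriented if no assumption on orientability of the surface is made. The ribbon graph of a map is the thickening of the map inside its surface: each vertex becomes a disc and each edge a ribbon (band) attached to the discs of its endpoints; removing an edge means deleting its ribbon. The faces of a ribbon graph correspond to its boundary components.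
   Formalization: A non-oriented map in (S1) is rooted by distinguishing an edge together with one of its two sides; with only an edge distinguished the two sets have different sizes for every n ≥ 3. Oriented maps in (S2) are rooted by an edge alone. *)

theory Defs
  imports Main "HOL-Combinatorics.Permutations"
begin

text \<open>
  A bicolored map is encoded by the combinatorics of its ribbon graph. Every edge is a ribbon
  with two sides, each side running from a white vertex disc to a black one. The
  surface is determined by three fixed-point-free involutions on the set of edge sides:
  \<^item> \<open>opp\<close> exchanges the two sides of the same edge;
  \<^item> \<open>wcor\<close> (resp. \<open>bcor\<close>) exchanges the two edge sides that bound the same corner
    at a white (resp. black) vertex.

  White vertices are the orbits of \<open>opp\<close> and \<open>wcor\<close>, black vertices those of \<open>opp\<close> and
  \<open>bcor\<close>. The surface is obtained by gluing a disc to each boundary component, so all faces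
  are discs. No orientability is assumed.
\<close>

record 'a bmap =
  sides :: "'a set"
  opp :: "'a \<Rightarrow> 'a"
  wcor :: "'a \<Rightarrow> 'a"
  bcor :: "'a \<Rightarrow> 'a"

definition fpf_involution_on :: "'a set \<Rightarrow> ('a \<Rightarrow> 'a) \<Rightarrow> bool" where
  "fpf_involution_on S f \<longleftrightarrow> f permutes S \<and> (\<forall>x\<in>S. f (f x) = x \<and> f x \<noteq> x)"

definition edges :: "'a bmap \<Rightarrow> 'a set set" where
  "edges M = {{x, opp M x} | x. x \<in> sides M}"

definition num_classes :: "'a set \<Rightarrow> ('a \<times> 'a) set \<Rightarrow> nat" where
  "num_classes A R = card (A // ((R \<union> R\<inverse>)\<^sup>* \<inter> A \<times> A))"

datatype colour = White | Black

text \<open>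
  The point \<open>(x, White)\<close> (resp. \<open>(x, Black)\<close>) is the end of the edge side \<open>x\<close> on the circle
  bounding its white (resp. black) vertex disc. These points cut the circles into two kinds of
  arcs: the corners, and the arcs along which the ribbons are attached. Together with the edge
  sides, these arcs describe the whole ribbon graph.
\<close>

definition points :: "'a bmap \<Rightarrow> ('a \<times> colour) set" where
  "points M = sides M \<times> UNIV"

definition corner_arcs :: "'a bmap \<Rightarrow> (('a \<times> colour) \<times> ('a \<times> colour)) set" where
  "corner_arcs M = {((x, White), (wcor M x, White)) | x. x \<in> sides M}
     \<union> {((x, Black), (bcor M x, Black)) | x. x \<in> sides M}"

definition attaching_arcs :: "'a bmap \<Rightarrow> 'a set \<Rightarrow> (('a \<times> colour) \<times> ('a \<times> colour)) set" where
  "attaching_arcs M X = {((x, c), (opp M x, c)) | x c. x \<in> X}"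

definition ribbon_sides :: "'a set \<Rightarrow> (('a \<times> colour) \<times> ('a \<times> colour)) set" where
  "ribbon_sides X = {((x, White), (x, Black)) | x. x \<in> X}"

text \<open>
  Both counts below refer to the ribbon graph of \<open>M\<close> with the ribbons of the edges in \<open>D\<close>
  deleted and all vertex discs kept, including those that become isolated (an isolated disc
  counts as one component with one face). The boundary of this ribbon graph
  consists of the corners, the sides of the remaining ribbons, and the attaching arcs freed by
  the deleted ribbons. Faces are its boundary components. For connectivity, each whole vertex
  circle is traversed, i.e. the corners and all attaching arcs.
\<close>

definition num_faces_without :: "'a bmap \<Rightarrow> 'a set set \<Rightarrow> nat" where
  "num_faces_without M D = num_classes (points M)
     (corner_arcs M \<union> ribbon_sides (sides M - \<Union>D) \<union> attaching_arcs M (\<Union>D))"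

definition num_components_without :: "'a bmap \<Rightarrow> 'a set set \<Rightarrow> nat" where
  "num_components_without M D = num_classes (points M)
     (corner_arcs M \<union> ribbon_sides (sides M - \<Union>D) \<union> attaching_arcs M (sides M))"

abbreviation num_faces :: "'a bmap \<Rightarrow> nat" where
  "num_faces M \<equiv> num_faces_without M {}"

definition is_map :: "'a bmap \<Rightarrow> bool" where
  "is_map M \<longleftrightarrow> finite (sides M)
     \<and> fpf_involution_on (sides M) (opp M)
     \<and> fpf_involution_on (sides M) (wcor M)
     \<and> fpf_involution_on (sides M) (bcor M)
     \<and> num_components_without M {} = 1"

text \<open>
  An orientation of the surface is given by the set of those edge sides that lie to the left
  when their edge is traversed from its white to its black end. Of the two sides of an edge, and
  of the two sides bounding a corner, exactly one is a left side; conversely, a set with this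
  property orients the surface.
\<close>

definition is_orientation :: "'a bmap \<Rightarrow> 'a set \<Rightarrow> bool" where
  "is_orientation M L \<longleftrightarrow> L \<subseteq> sides M \<and>
     (\<forall>x\<in>sides M. (opp M x \<in> L \<longleftrightarrow> x \<notin> L) \<and> (wcor M x \<in> L \<longleftrightarrow> x \<notin> L)
       \<and> (bcor M x \<in> L \<longleftrightarrow> x \<notin> L))"

definition first_edges :: "'a bmap \<Rightarrow> ('a set \<times> 'a set) set \<Rightarrow> nat \<Rightarrow> 'a set set" where
  "first_edges M r i = {a \<in> edges M. card {b \<in> edges M. (b, a) \<in> r} \<le> i}"

definition map_iso :: "'a bmap \<Rightarrow> 'b bmap \<Rightarrow> ('a \<Rightarrow> 'b) \<Rightarrow> bool" where
  "map_iso M M' f \<longleftrightarrow> bij_betw f (sides M) (sides M') \<and>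
     (\<forall>x\<in>sides M. f (opp M x) = opp M' (f x) \<and> f (wcor M x) = wcor M' (f x)
       \<and> f (bcor M x) = bcor M' (f x))"

definition order_iso :: "'a bmap \<Rightarrow> ('a set \<times> 'a set) set \<Rightarrow> ('b set \<times> 'b set) set \<Rightarrow> ('a \<Rightarrow> 'b) \<Rightarrow> bool"
  where "order_iso M r r' f \<longleftrightarrow> (\<forall>a\<in>edges M. \<forall>b\<in>edges M. (a, b) \<in> r \<longleftrightarrow> (f ` a, f ` b) \<in> r')"

text \<open>
  Since maps are counted up to isomorphism, the edge sides of a map with \<open>n\<close> edges may be taken
  to be \<open>{..<2 * n}\<close>.

  On a non-oriented map the root is a distinguished edge together with one of its
  sides, as usual for non-oriented maps (this is what makes a rooted map free of non-trivial
  automorphisms). On an oriented map, the root is just an edge: the orientation singles out its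
  left side.
\<close>

type_synonym nonoriented_ordered = "nat bmap \<times> nat \<times> (nat set \<times> nat set) set"

definition nonoriented_labelled :: "nat \<Rightarrow> nonoriented_ordered set" where
  "nonoriented_labelled n = {(M, root, r).
     is_map M \<and> sides M = {..<2 * n} \<and> root \<in> sides M \<and>
     num_faces M = 1 \<and>
     linear_order_on (edges M) r \<and>
     (\<forall>i. 1 \<le> i \<and> i < n \<longrightarrow>
        num_components_without M (first_edges M r i) = num_faces_without M (first_edges M r i))}"

definition nonoriented_iso :: "nonoriented_ordered \<Rightarrow> nonoriented_ordered \<Rightarrow> bool" where
  "nonoriented_iso = (\<lambda>(M, root, r) (M', root', r').
     \<exists>f. map_iso M M' f \<and> f root = root' \<and> order_iso M r r' f)"

definition S1 :: "nat \<Rightarrow> nonoriented_ordered set set" where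
  "S1 n = nonoriented_labelled n //
     {(P, Q). P \<in> nonoriented_labelled n \<and> Q \<in> nonoriented_labelled n \<and> nonoriented_iso P Q}"

type_synonym oriented_ordered = "nat bmap \<times> nat set \<times> nat set \<times> (nat set \<times> nat set) set"

definition oriented_labelled :: "nat \<Rightarrow> oriented_ordered set" where
  "oriented_labelled n = {(M, L, root, r).
     is_map M \<and> sides M = {..<2 * n} \<and> is_orientation M L \<and> root \<in> edges M \<and>
     linear_order_on (edges M) r}"

definition oriented_iso :: "oriented_ordered \<Rightarrow> oriented_ordered \<Rightarrow> bool" where
  "oriented_iso = (\<lambda>(M, L, root, r) (M', L', root', r').
     \<exists>f. map_iso M M' f \<and> f ` L = L' \<and> f ` root = root' \<and> order_iso M r r' f)"

definition S2 :: "nat \<Rightarrow> oriented_ordered set set" where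
  "S2 n = oriented_labelled n //
     {(P, Q). P \<in> oriented_labelled n \<and> Q \<in> oriented_labelled n \<and> oriented_iso P Q}"

end

theory Submission
  imports Defs
begin

text \<open>
  Relabelling the edge sides acts freely on both kinds of labelled objects, so it is enough to
  count these. Fix a map and its order, and consider all maps obtained by twisting some of its
  edges. Add the edges to the vertex discs from the last one to the first one. As long as
  every component has exactly one face, an edge that joins two components preserves this
  property whether it is twisted or not, and an edge inside a component preserves it for exactly
  one of the two choices. With \<open>V\<close> vertices there are \<open>V - 1\<close> edges of the first kind, so
  \<open>2\<^bsup>V - 1\<^esup>\<close> of the sets of twists satisfy the condition of the theorem. On the other hand there
  are \<open>2\<^bsup>V\<^esup>\<close> ways to orient the vertex discs separately, and for each of them exactly one
  set of twists turns these orientations into an orientation of the surface. Hence twice the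
  number of suitable non-oriented maps equals the number of oriented maps; the factor
  two is absorbed by the root, which is an edge side in the first case and an edge in the second.
\<close>

section \<open>Connected components of a relation\<close>

text \<open>Faces are the classes of a union of two perfect matchings on the ends of edge sides:
  \<open>cor\<close> follows the corners, \<open>rib\<close> follows a ribbon or, where it is
  missing, the attaching arc. Inserting a ribbon changes \<open>rib\<close> at four points only; an
  absent, a plain and a twisted ribbon are the three ways to pair them. What remains consists of
  cycles and two paths ending at these points, and only the pairing that joins the ends of each path
  yields two cycles instead of one. If the absent ribbon has two cycles, both other pairings merge
  them; if it has one, exactly one of the other pairings has two. This is the source of the
  one-out-of-two rule.

  The condition of the theorem says that faces and components are equinumerous at all stages: with
  all ribbons present this is the one-face condition, with none it is automatic.

  Different sets of twists may give the same labelled map (twisting the edge at a black vertex of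
  degree one changes nothing), so pairs of a map and a set of edges are counted instead. Both sides
  then acquire a factor \<open>2 ^ n\<close>, which cancels.

  The bijection is not explicit: it comes from equal finite cardinalities.\<close>

definition conn :: "('a \<times> 'a) set \<Rightarrow> ('a \<times> 'a) set" where
  "conn R = (R \<union> R\<inverse>)\<^sup>*"

lemma conn_refl [simp]: "(x, x) \<in> conn R"
  by (simp add: conn_def)

lemma conn_sym: "(x, y) \<in> conn R \<Longrightarrow> (y, x) \<in> conn R"
  unfolding conn_def by (metis Un_commute converse_Un converse_converse rtrancl_converseD)

lemma conn_trans: "(x, y) \<in> conn R \<Longrightarrow> (y, z) \<in> conn R \<Longrightarrow> (x, z) \<in> conn R"
  unfolding conn_def by (rule rtrancl_trans)

lemma subset_conn: "R \<subseteq> conn R"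
  unfolding conn_def by auto

lemma conn_least:
  assumes "R \<subseteq> conn R'"
  shows "conn R \<subseteq> conn R'"
proof -
  have "R \<union> R\<inverse> \<subseteq> conn R'"
    using assms by (auto intro: conn_sym)
  then have "(R \<union> R\<inverse>)\<^sup>* \<subseteq> (conn R')\<^sup>*"
    by (rule rtrancl_mono)
  then show ?thesis
    by (simp add: conn_def)
qed

lemma conn_mono: "R \<subseteq> R' \<Longrightarrow> conn R \<subseteq> conn R'"
  by (rule conn_least) (use subset_conn[of R'] in blast)

lemma conn_eqI: "R \<subseteq> conn R' \<Longrightarrow> R' \<subseteq> conn R \<Longrightarrow> conn R = conn R'"
  by (intro subset_antisym conn_least)

text \<open>A path needs the new pair at most once, in one of its two directions. All later
  questions about a relation with added pairs are reduced to the old relation by this rule.\<close>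

lemma conn_insert:
  "(x, y) \<in> conn (insert (p, q) R) \<longleftrightarrow>
     (x, y) \<in> conn R \<or> (x, p) \<in> conn R \<and> (q, y) \<in> conn R \<or> (x, q) \<in> conn R \<and> (p, y) \<in> conn R"
  (is "_ \<longleftrightarrow> ?T x y")
proof
  assume "(x, y) \<in> conn (insert (p, q) R)"
  then show "?T x y"
    unfolding conn_def[of "insert (p, q) R"]
  proof induction
    case base
    then show ?case by simp
  next
    case (step y z)
    from step.hyps(2) consider "(y, z) \<in> conn R" | "y = p" "z = q" | "y = q" "z = p"
      using subset_conn[of R] conn_sym[of z y R] by blast
    then show ?case
    proof cases
      case 1
      then show ?thesis using step.IH conn_trans[of _ y R z] by blast
    next
      case 2
      then show ?thesis using step.IH conn_sym[of y q R] conn_trans[of x q R y] by auto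
    next
      case 3
      then show ?thesis using step.IH conn_sym[of y p R] conn_trans[of x p R y] by auto
    qed
  qed
next
  let ?C = "conn (insert (p, q) R)"
  have pq: "(p, q) \<in> ?C" "(q, p) \<in> ?C" and sub: "conn R \<subseteq> ?C"
    using subset_conn[of "insert (p, q) R"] conn_mono[of R "insert (p, q) R"]
    by (auto intro: conn_sym)
  assume "?T x y"
  then show "(x, y) \<in> ?C"
    using sub conn_trans[OF conn_trans[OF _ pq(1)], of x y] conn_trans[OF conn_trans[OF _ pq(2)], of x y]
    by blast
qed

lemma equiv_conn: "equiv A (conn R \<inter> A \<times> A)"
  by (intro equivI refl_onI symI transI) (auto dest: conn_sym, metis conn_trans)

lemma num_classes_conn: "num_classes A R = card (A // (conn R \<inter> A \<times> A))"
  by (simp add: num_classes_def conn_def)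

lemma num_classes_cong: "conn R = conn R' \<Longrightarrow> num_classes A R = num_classes A R'"
  by (simp add: num_classes_conn)

lemma num_classes_insert_same:
  "(p, q) \<in> conn R \<Longrightarrow> num_classes A (insert (p, q) R) = num_classes A R"
  using subset_conn[of R] subset_conn[of "insert (p, q) R"]
  by (intro num_classes_cong conn_eqI) blast+

text \<open>The classes of \<open>p\<close> and \<open>q\<close> merge into one and all others
  survive.\<close>

lemma num_classes_insert:
  assumes "finite A" "p \<in> A" "q \<in> A" and pq: "(p, q) \<notin> conn R"
  shows "num_classes A R = Suc (num_classes A (insert (p, q) R))"
proof -
  define E where "E = conn R \<inter> A \<times> A"
  define E' where "E' = conn (insert (p, q) R) \<inter> A \<times> A"
  have eq: "equiv A E" and eq': "equiv A E'"
    unfolding E_def E'_def by (rule equiv_conn)+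
  have cls: "E' `` {x} = (if x \<in> E `` {p} \<union> E `` {q} then E `` {p} \<union> E `` {q} else E `` {x})"
    if "x \<in> A" for x
    using that assms(2,3) unfolding E_def E'_def
    by (auto simp: conn_insert) (meson conn_sym conn_trans)+
  let ?p = "E `` {p}" and ?q = "E `` {q}"
  have in_pq: "x \<in> ?p \<union> ?q \<longleftrightarrow> E `` {x} = ?p \<or> E `` {x} = ?q" if "x \<in> A" for x
    using eq_equiv_class_iff[OF eq that assms(2)] eq_equiv_class_iff[OF eq that assms(3)]
      that assms(2,3) conn_sym[of x] conn_sym[of _ x] by (auto simp: E_def)
  have "A // E' = insert (?p \<union> ?q) (A // E - {?p, ?q})"
  proof
    show "A // E' \<subseteq> insert (?p \<union> ?q) (A // E - {?p, ?q})"
    proof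
      fix C assume "C \<in> A // E'"
      then obtain x where x: "x \<in> A" "C = E' `` {x}"
        by (auto elim: quotientE)
      then show "C \<in> insert (?p \<union> ?q) (A // E - {?p, ?q})"
        using in_pq[OF x(1)] cls[OF x(1)] by (auto intro: quotientI)
    qed
  next
    show "insert (?p \<union> ?q) (A // E - {?p, ?q}) \<subseteq> A // E'"
    proof
      fix C assume "C \<in> insert (?p \<union> ?q) (A // E - {?p, ?q})"
      then consider "C = ?p \<union> ?q" | x where "x \<in> A" "C = E `` {x}" "C \<noteq> ?p" "C \<noteq> ?q"
        by (auto simp: quotient_def)
      then show "C \<in> A // E'"
      proof cases
        case 1
        have "p \<in> ?p"
          using assms(2) by (simp add: E_def)
        then have "E' `` {p} = C"
          using 1 cls[of p] assms(2) by simp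
        then show ?thesis
          using assms(2) by (auto simp: quotient_def)
      next
        case 2
        then have "E' `` {x} = C"
          using cls[of x] in_pq[of x] by simp
        then show ?thesis
          using 2 by (auto simp: quotient_def)
      qed
    qed
  qed
  \<comment> \<open>The merged class must be new, otherwise inserting it would not contribute to the
    cardinality.\<close>
  moreover have "?p \<union> ?q \<notin> A // E"
  proof
    assume "?p \<union> ?q \<in> A // E"
    moreover have "p \<in> ?p \<union> ?q" "q \<in> ?p \<union> ?q"
      using assms(2,3) by (auto simp: E_def)
    ultimately have "(p, q) \<in> E"
      using quotient_eq_iff[OF eq, of "?p \<union> ?q" "?p \<union> ?q" p q] by blast
    with pq show False by (simp add: E_def)
  qed
  moreover have "?p \<noteq> ?q"
    using eq_equiv_class_iff[OF eq] assms by (auto simp: E_def)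
  moreover have "?p \<in> A // E" "?q \<in> A // E" "finite (A // E)"
    using assms by (auto simp: quotient_def)
  moreover from this have "{?p, ?q} \<subseteq> A // E" by simp
  ultimately show ?thesis
    using card_mono[of "A // E" "{?p, ?q}"]
    by (simp add: num_classes_conn E_def[symmetric] E'_def[symmetric] card_Diff_subset)
qed

text \<open>Sending a class of \<open>R\<close> to the class of \<open>R'\<close> around it is a
  surjection; equal finite numbers make it injective, so that the two relations agree on
  \<open>A\<close>. Applied to faces inside components, the second part says that equal counts mean
  one face per component.\<close>

lemma num_classes_mono:
  assumes "finite A" "conn R \<subseteq> conn R'"
  shows "num_classes A R' \<le> num_classes A R"
    and "num_classes A R' = num_classes A R \<Longrightarrow> x \<in> A \<Longrightarrow> y \<in> A \<Longrightarrow> (x, y) \<in> conn R' \<Longrightarrow> (x, y) \<in> conn R"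
proof -
  define E where "E = conn R \<inter> A \<times> A"
  define E' where "E' = conn R' \<inter> A \<times> A"
  have eq: "equiv A E" and eq': "equiv A E'"
    unfolding E_def E'_def by (rule equiv_conn)+
  have *: "E' `` (E `` {x}) = E' `` {x}" if "x \<in> A" for x
  proof -
    have "E \<subseteq> E'" "(x, x) \<in> E" "trans E'"
      using that assms(2) eq' by (auto simp: E_def E'_def equiv_def)
    then show ?thesis
      by (blast dest: transD)
  qed
  have img: "(``) E' ` (A // E) = A // E'"
    using * by (auto simp: quotient_def image_iff)
  have fin: "finite (A // E)"
    using assms by (auto simp: quotient_def)
  show "num_classes A R' \<le> num_classes A R"
    unfolding num_classes_conn E_def[symmetric] E'_def[symmetric]
    using card_image_le[OF fin, of "(``) E'"] img by simp
  assume "num_classes A R' = num_classes A R" and xy: "x \<in> A" "y \<in> A" "(x, y) \<in> conn R'"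
  then have "inj_on ((``) E') (A // E)"
    unfolding num_classes_conn E_def[symmetric] E'_def[symmetric]
    using eq_card_imp_inj_on[OF fin, of "(``) E'"] img by simp
  moreover have "E' `` (E `` {x}) = E' `` (E `` {y})"
    using * xy equiv_class_eq_iff[OF eq', of x y] by (simp add: E'_def)
  moreover have "E `` {x} \<in> A // E" "E `` {y} \<in> A // E"
    using xy by (auto simp: quotient_def)
  ultimately have "E `` {x} = E `` {y}"
    by (meson inj_onD)
  then have "(x, y) \<in> E"
    using eq_equiv_class_iff[OF eq] xy by blast
  then show "(x, y) \<in> conn R"
    by (simp add: E_def)
qed

lemma conn_image:
  assumes "inj_on h A" "R \<subseteq> A \<times> A" "x \<in> A" "y \<in> A"
  shows "(h x, h y) \<in> conn (map_prod h h ` R) \<longleftrightarrow> (x, y) \<in> conn R"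
proof
  assume "(h x, h y) \<in> conn (map_prod h h ` R)"
  then have "\<exists>z\<in>A. h y = h z \<and> (x, z) \<in> conn R"
    unfolding conn_def[of "map_prod h h ` R"]
  proof induction
    case base
    then show ?case using assms(3) by auto
  next
    case (step u v)
    then obtain z where z: "z \<in> A" "u = h z" "(x, z) \<in> conn R" by auto
    from step.hyps(2) obtain s t where st: "(s, t) \<in> R \<or> (t, s) \<in> R" "u = h s" "v = h t" by auto
    then have "s \<in> A" "t \<in> A" using assms(2) by auto
    then have "s = z" using st z assms(1) by (metis inj_onD)
    moreover have "(s, t) \<in> conn R"
      using st(1) subset_conn[of R] conn_sym[of t s R] by blast
    ultimately show ?case
      using \<open>t \<in> A\<close> st(3) conn_trans[OF z(3)] by blast
  qed
  then show "(x, y) \<in> conn R"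
    using assms(1,4) by (metis inj_onD)
next
  assume "(x, y) \<in> conn R"
  then show "(h x, h y) \<in> conn (map_prod h h ` R)"
    unfolding conn_def[of R]
  proof induction
    case base
    then show ?case by simp
  next
    case (step u v)
    then have "(h u, h v) \<in> conn (map_prod h h ` R)"
      using subset_conn[of "map_prod h h ` R"] conn_sym[of "h v" "h u"] by force
    with step.IH show ?case by (rule conn_trans)
  qed
qed

text \<open>Used for two renamings: of the black ends in \<open>black_swap\<close>, and of the edge
  sides in \<open>move\<close>.\<close>

lemma num_classes_image:
  assumes "inj_on h A" "R \<subseteq> A \<times> A"
  shows "num_classes (h ` A) (map_prod h h ` R) = num_classes A R"
proof -
  define E where "E = conn R \<inter> A \<times> A"
  define E' where "E' = conn (map_prod h h ` R) \<inter> h ` A \<times> h ` A"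
  have *: "E' `` {h x} = h ` (E `` {x})" if "x \<in> A" for x
    using that conn_image[OF assms that] by (auto simp: E_def E'_def)
  have "(h ` A) // E' = (`) h ` (A // E)"
    using * by (auto simp: quotient_def image_iff)
  moreover have "inj_on ((`) h) (A // E)"
    by (rule inj_on_subset[OF inj_on_image_Pow[OF assms(1)]]) (auto simp: quotient_def E_def)
  ultimately show ?thesis
    by (simp add: num_classes_conn E_def[symmetric] E'_def[symmetric] card_image)
qed

section \<open>Two-colourings of a pair of matchings\<close>

text \<open>Unlike \<open>fpf_involution_on\<close>, nothing is required outside \<open>S\<close>,
  so the notion passes to closed subsets and to the matching \<open>rib\<close>, which is not the
  identity off the points.\<close>

definition fpf :: "'a set \<Rightarrow> ('a \<Rightarrow> 'a) \<Rightarrow> bool" where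
  "fpf S f \<longleftrightarrow> (\<forall>x\<in>S. f x \<in> S \<and> f (f x) = x \<and> f x \<noteq> x)"

text \<open>A proper two-colouring of the matching \<open>f\<close>. For \<open>opp\<close>,
  \<open>wcor\<close> and \<open>bcor\<close> it is also the condition on the left sides of an
  orientation, so colourings and orientations are counted by the same lemma.\<close>

definition flipped :: "'a set \<Rightarrow> ('a \<Rightarrow> 'a) \<Rightarrow> 'a set \<Rightarrow> bool" where
  "flipped S f L \<longleftrightarrow> (\<forall>x\<in>S. f x \<in> L \<longleftrightarrow> x \<notin> L)"

definition graph :: "'a set \<Rightarrow> ('a \<Rightarrow> 'a) \<Rightarrow> ('a \<times> 'a) set" where
  "graph S f = (\<lambda>x. (x, f x)) ` S"

text \<open>
  An equation \<open>f y = (f g)\<^sup>k y\<close> shrinks from both ends until \<open>f\<close> or \<open>g\<close> has a fixed point;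
  hence the cycles of \<open>f g\<close> come in pairs exchanged by \<open>f\<close>.
\<close>

lemma fpf_funpow_neq:
  assumes "fpf S f" "fpf S g"
  shows "y \<in> S \<Longrightarrow> f y \<noteq> ((\<lambda>x. f (g x)) ^^ k) y"
proof (induction k arbitrary: y rule: nat_less_induct)
  case (1 k)
  let ?T = "\<lambda>x. f (g x)"
  show ?case
  proof
    assume eq: "f y = (?T ^^ k) y"
    consider "k = 0" | "k = 1" | j where "k = Suc (Suc j)"
      by (metis One_nat_def not0_implies_Suc)
    then show False
    proof cases
      case 1
      then show ?thesis using eq assms \<open>y \<in> S\<close> by (auto simp: fpf_def)
    next
      case 2
      then have "f (f y) = f (f (g y))" using eq by simp
      then show ?thesis using assms \<open>y \<in> S\<close> by (auto simp: fpf_def)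
    next
      case 3
      let ?z = "?T y" and ?u = "(?T ^^ j) (?T y)"
      have zS: "?z \<in> S" using assms \<open>y \<in> S\<close> by (auto simp: fpf_def)
      have uS: "?u \<in> S"
        using zS assms by (induction j) (auto simp: fpf_def)
      have "f y = ?T ?u"
        using eq 3 by (metis funpow_Suc_right comp_apply funpow.simps(2))
      then have "f (f y) = f (f (g ?u))" by simp
      then have "g y = g (g ?u)"
        using assms \<open>y \<in> S\<close> uS by (auto simp: fpf_def)
      moreover have "f ?z = g y"
        using assms \<open>y \<in> S\<close> by (auto simp: fpf_def)
      ultimately have "f ?z = ?u"
        using assms uS by (auto simp: fpf_def)
      then show ?thesis
        using "1.IH" 3 zS by auto
    qed
  qed
qed

text \<open>The components of two perfect matchings are even cycles. A colour class is a union of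
  cycles of \<open>f g\<close>, one from each pair exchanged by \<open>f\<close>; it is found as a
  maximal set closed under \<open>f g\<close> and disjoint from its image under
  \<open>f\<close>.\<close>

lemma ex_flipped:
  assumes "finite S" and f: "fpf S f" and g: "fpf S g"
  shows "\<exists>L\<subseteq>S. flipped S f L \<and> flipped S g L"
proof -
  let ?T = "\<lambda>x. f (g x)"
  define ok where "ok L \<longleftrightarrow> L \<subseteq> S \<and> ?T ` L \<subseteq> L \<and> (\<forall>x\<in>L. f x \<notin> L)" for L
  have fS: "f x \<in> S" "f (f x) = x" "f x \<noteq> x" and gS: "g x \<in> S" "g (g x) = x" "g x \<noteq> x" if "x \<in> S" for x
    using that f g by (auto simp: fpf_def)
  have "finite {L. ok L}"
    by (rule finite_subset[of _ "Pow S"]) (use assms in \<open>auto simp: ok_def\<close>)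
  moreover have "ok {}" by (simp add: ok_def)
  ultimately have "\<exists>L\<in>{L. ok L}. \<forall>L'\<in>{L. ok L}. L \<subseteq> L' \<longrightarrow> L = L'"
    by (intro finite_has_maximal) blast+
  then obtain L where L: "ok L" and max: "\<And>L'. ok L' \<Longrightarrow> L \<subseteq> L' \<Longrightarrow> L = L'"
    by blast
  have LS: "L \<subseteq> S" and dis: "\<And>x. x \<in> L \<Longrightarrow> f x \<notin> L"
    using L by (auto simp: ok_def)
  have "inj_on ?T L"
    by (rule inj_on_inverseI[where g = "\<lambda>x. g (f x)"]) (use LS fS(2) gS in \<open>simp add: subset_iff\<close>)
  \<comment> \<open>An injective self-map of a finite set is onto, so \<open>L\<close> is also
    closed under the inverse of \<open>f g\<close>; the argument for \<open>g2\<close> depends on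
    this.\<close>
  then have inv: "?T ` L = L"
    using L finite_subset[OF LS assms(1)] by (intro endo_inj_surj) (auto simp: ok_def)
  \<comment> \<open>Otherwise the forward orbit of \<open>x\<close> under \<open>f g\<close> could
    be added to \<open>L\<close>, against maximality.\<close>
  have cover: "x \<in> L \<or> f x \<in> L" if x: "x \<in> S" for x
  proof (rule ccontr)
    assume n: "\<not> (x \<in> L \<or> f x \<in> L)"
    define orb where "orb = range (\<lambda>k. (?T ^^ k) x)"
    have pw: "(?T ^^ k) y \<in> S" if "y \<in> S" for y k
      using that by (induction k) (auto simp: fS gS)
    have pwL: "(?T ^^ k) y \<in> L" if "y \<in> L" for y k
      using that L by (induction k) (auto simp: ok_def)
    \<comment> \<open>Conjugation by \<open>f\<close> turns \<open>f g\<close> into its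
      inverse.\<close>
    have rev: "(?T ^^ k) (f ((?T ^^ k) y)) = f y" if "y \<in> S" for y k
      using that
    proof (induction k arbitrary: y)
      case (Suc k)
      have "(?T ^^ Suc k) (f ((?T ^^ Suc k) y)) = ?T ((?T ^^ k) (f ((?T ^^ k) (?T y))))"
        using funpow_swap1[of ?T k y] by simp
      also have "\<dots> = ?T (f (?T y))"
        using Suc fS gS by simp
      also have "\<dots> = f y"
        using Suc.prems fS gS by simp
      finally show ?case .
    qed simp
    have OO: "f y \<notin> orb" if "y \<in> orb" for y
    proof
      assume "f y \<in> orb"
      then obtain i j where ij: "y = (?T ^^ i) x" "f y = (?T ^^ j) x"
        using \<open>y \<in> orb\<close> by (auto simp: orb_def)
      have "f x = (?T ^^ (i + j)) x"
        using rev[OF x, of i] ij by (simp add: funpow_add)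
      then show False
        using fpf_funpow_neq[OF f g x] by blast
    qed
    have LO: "f y \<notin> L" if "y \<in> orb" for y
    proof
      assume "f y \<in> L"
      with \<open>y \<in> orb\<close> obtain k where "f ((?T ^^ k) x) \<in> L"
        by (auto simp: orb_def)
      from pwL[OF this, of k] have "f x \<in> L"
        using rev[OF x] by simp
      with n show False by simp
    qed
    have OS: "orb \<subseteq> S"
      using pw[OF x] by (auto simp: orb_def)
    have "f y \<notin> orb" if "y \<in> L" for y
    proof
      assume "f y \<in> orb"
      from LO[OF this] show False
        using that fS(2)[of y] LS by auto
    qed
    moreover have "?T ` orb \<subseteq> orb"
    proof -
      have "?T ((?T ^^ k) x) = (?T ^^ Suc k) x" for k by simp
      then show ?thesis unfolding orb_def by blast
    qed
    ultimately have "ok (L \<union> orb)"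
      using L OO LO OS by (auto simp: ok_def)
    then have "L = L \<union> orb" using max by blast
    moreover have "x \<in> orb"
      unfolding orb_def by (metis funpow_0 rangeI)
    ultimately show False using n by blast
  qed
  have g1: "g x \<notin> L" if "x \<in> L" for x
  proof
    assume "g x \<in> L"
    moreover have "?T x \<in> L" using L that by (auto simp: ok_def)
    ultimately show False using dis by blast
  qed
  have g2: "g x \<in> L" if "x \<in> S" "x \<notin> L" for x
  proof -
    have "f x \<in> ?T ` L" using cover[OF that(1)] that(2) unfolding inv by simp
    then obtain z where z: "z \<in> L" "f x = f (g z)"
      by blast
    then have zS: "z \<in> S" using LS by blast
    have "x = g z"
      using z(2) fS(2)[OF that(1)] fS(2)[OF gS(1)[OF zS]] by metis
    then show ?thesis
      using z(1) gS(2)[OF zS] by simp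
  qed
  have "flipped S f L" "flipped S g L"
    unfolding flipped_def using dis cover g1 g2 by blast+
  then show ?thesis
    using LS by blast
qed

text \<open>A two-colouring for the pair \<open>f\<close>, \<open>f\<close> splits \<open>S\<close>
  into two halves exchanged by \<open>f\<close>.\<close>

lemma even_card_fpf:
  assumes "finite S" "fpf S f"
  shows "even (card S)"
proof -
  obtain L where L: "L \<subseteq> S" "flipped S f L"
    using ex_flipped[OF assms assms(2)] by blast
  have "bij_betw f L (S - L)"
  proof (rule bij_betw_byWitness[where f' = f])
    show "\<forall>a\<in>L. f (f a) = a" "\<forall>a\<in>S - L. f (f a) = a"
      using L(1) assms(2) by (auto simp: fpf_def)
    have "f x \<in> S \<and> (f x \<in> L \<longleftrightarrow> x \<notin> L)" if "x \<in> S" for x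
      using that L(2) assms(2) by (auto simp: flipped_def fpf_def)
    then show "f ` L \<subseteq> S - L" "f ` (S - L) \<subseteq> L"
      using L(1) by blast+
  qed
  then have "card L = card (S - L)"
    by (rule bij_betw_same_card)
  moreover have "card S = card L + card (S - L)"
    using L assms card_Diff_subset[of L S] card_mono[of S L] finite_subset[of L S] by simp
  ultimately show ?thesis by simp
qed

text \<open>Both colourings change along every pair of \<open>R\<close>, so whether they agree is
  constant along a path.\<close>

lemma flipped_agree:
  assumes "\<And>u v. (u, v) \<in> R \<Longrightarrow> (u \<in> L \<longleftrightarrow> v \<notin> L) \<and> (u \<in> L' \<longleftrightarrow> v \<notin> L')"
    and "(x, y) \<in> conn R"
  shows "(x \<in> L \<longleftrightarrow> x \<in> L') \<longleftrightarrow> (y \<in> L \<longleftrightarrow> y \<in> L')"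
  using assms(2) unfolding conn_def
proof induction
  case (step y z)
  then have "(y \<in> L \<longleftrightarrow> z \<notin> L) \<and> (y \<in> L' \<longleftrightarrow> z \<notin> L')"
    using assms(1)[of y z] assms(1)[of z y] by auto
  with step.IH show ?case by blast
qed simp

text \<open>Relative to one fixed colouring \<open>L0\<close>, the others are obtained by
  complementing it on an arbitrary set of classes, because two colourings agree everywhere or
  nowhere on a class.\<close>

lemma card_flipped:
  assumes "finite S" and f: "fpf S f" and g: "fpf S g"
  shows "card {L. L \<subseteq> S \<and> flipped S f L \<and> flipped S g L} = 2 ^ num_classes S (graph S f \<union> graph S g)"
proof -
  let ?R = "graph S f \<union> graph S g"
  define E where "E = conn ?R \<inter> S \<times> S"
  have eq: "equiv S E" unfolding E_def by (rule equiv_conn)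
  obtain L0 where L0: "L0 \<subseteq> S" "flipped S f L0" "flipped S g L0"
    using ex_flipped[OF assms] by blast
  let ?F = "{L. L \<subseteq> S \<and> flipped S f L \<and> flipped S g L}"
  have E_f: "(x, f x) \<in> E" and E_g: "(x, g x) \<in> E" if "x \<in> S" for x
    using that subset_conn[of ?R] f g by (auto simp: E_def graph_def fpf_def)
  have un: "x \<in> \<Union>U \<longleftrightarrow> E `` {x} \<in> U" if "U \<subseteq> S // E" "x \<in> S" for x U
  proof
    assume "x \<in> \<Union>U"
    then obtain C where C: "C \<in> U" "x \<in> C" by blast
    then have "E `` {x} = C"
      using that eq by (metis Image_singleton_iff equiv_class_eq quotientE subsetD)
    with C show "E `` {x} \<in> U" by simp
  next
    assume "E `` {x} \<in> U"
    then show "x \<in> \<Union>U"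
      using equiv_class_self[OF eq] that by blast
  qed
  have cls: "E `` {f x} = E `` {x}" "E `` {g x} = E `` {x}" if "x \<in> S" for x
    using equiv_class_eq[OF eq E_f[OF that]] equiv_class_eq[OF eq E_g[OF that]] by simp_all
  have "bij_betw (\<lambda>U. {x\<in>S. x \<in> L0 \<longleftrightarrow> x \<notin> \<Union>U}) (Pow (S // E)) ?F"
  proof (rule bij_betw_byWitness[where f' = "\<lambda>L. {C \<in> S // E. \<exists>x\<in>C. x \<in> L0 \<longleftrightarrow> x \<notin> L}"])
    show "\<forall>U\<in>Pow (S // E). {C \<in> S // E. \<exists>x\<in>C. x \<in> L0 \<longleftrightarrow> x \<notin> {x\<in>S. x \<in> L0 \<longleftrightarrow> x \<notin> \<Union>U}} = U"
    proof
      fix U assume "U \<in> Pow (S // E)"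
      then have U: "U \<subseteq> S // E" by simp
      have "(\<exists>x\<in>C. x \<in> L0 \<longleftrightarrow> x \<notin> {x\<in>S. x \<in> L0 \<longleftrightarrow> x \<notin> \<Union>U}) \<longleftrightarrow> C \<in> U" if C: "C \<in> S // E" for C
      proof -
        obtain y where y: "y \<in> S" "C = E `` {y}" using C by (rule quotientE)
        have CS: "C \<subseteq> S" and yC: "y \<in> C" using y equiv_class_self[OF eq] by (auto simp: E_def)
        have *: "x \<in> \<Union>U \<longleftrightarrow> C \<in> U" if "x \<in> C" for x
          using un[OF U] equiv_class_eq[OF eq, of y x] y CS that by auto
        then show ?thesis using CS yC by auto
      qed
      then show "{C \<in> S // E. \<exists>x\<in>C. x \<in> L0 \<longleftrightarrow> x \<notin> {x\<in>S. x \<in> L0 \<longleftrightarrow> x \<notin> \<Union>U}} = U"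
        using U by blast
    qed
    show "\<forall>L\<in>?F. {x\<in>S. x \<in> L0 \<longleftrightarrow> x \<notin> \<Union>{C \<in> S // E. \<exists>x\<in>C. x \<in> L0 \<longleftrightarrow> x \<notin> L}} = L"
    proof
      fix L assume "L \<in> ?F"
      then have L: "L \<subseteq> S" "flipped S f L" "flipped S g L" by auto
      have agree: "(x \<in> L0 \<longleftrightarrow> x \<in> L) \<longleftrightarrow> (y \<in> L0 \<longleftrightarrow> y \<in> L)" if "(x, y) \<in> E" for x y
        by (rule flipped_agree[of ?R]) (use L L0 that in \<open>auto simp: graph_def flipped_def E_def\<close>)
      have "x \<in> \<Union>{C \<in> S // E. \<exists>x\<in>C. x \<in> L0 \<longleftrightarrow> x \<notin> L} \<longleftrightarrow> (x \<in> L0 \<longleftrightarrow> x \<notin> L)" if "x \<in> S" for x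
      proof -
        have "x \<in> \<Union>{C \<in> S // E. \<exists>x\<in>C. x \<in> L0 \<longleftrightarrow> x \<notin> L} \<longleftrightarrow> (\<exists>y\<in>E `` {x}. y \<in> L0 \<longleftrightarrow> y \<notin> L)"
          using un[of "{C \<in> S // E. \<exists>x\<in>C. x \<in> L0 \<longleftrightarrow> x \<notin> L}" x] that by (auto intro: quotientI)
        then show ?thesis
          using agree equiv_class_self[OF eq that] by blast
      qed
      then show "{x\<in>S. x \<in> L0 \<longleftrightarrow> x \<notin> \<Union>{C \<in> S // E. \<exists>x\<in>C. x \<in> L0 \<longleftrightarrow> x \<notin> L}} = L"
        using L by blast
    qed
    show "(\<lambda>U. {x\<in>S. x \<in> L0 \<longleftrightarrow> x \<notin> \<Union>U}) ` Pow (S // E) \<subseteq> ?F"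
    proof (rule image_subsetI)
      fix U assume "U \<in> Pow (S // E)"
      then have *: "x \<in> \<Union>U \<longleftrightarrow> E `` {x} \<in> U" if "x \<in> S" for x
        using un that by blast
      have "flipped S h {x\<in>S. x \<in> L0 \<longleftrightarrow> x \<notin> \<Union>U}"
        if h: "fpf S h" "flipped S h L0" "\<And>x. x \<in> S \<Longrightarrow> E `` {h x} = E `` {x}" for h
        unfolding flipped_def
      proof
        fix x assume x: "x \<in> S"
        then have "h x \<in> S" "h x \<in> L0 \<longleftrightarrow> x \<notin> L0"
          using h by (auto simp: fpf_def flipped_def)
        then show "h x \<in> {x\<in>S. x \<in> L0 \<longleftrightarrow> x \<notin> \<Union>U} \<longleftrightarrow> x \<notin> {x\<in>S. x \<in> L0 \<longleftrightarrow> x \<notin> \<Union>U}"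
          using *[of x] *[of "h x"] h(3)[OF x] x by (auto simp del: Union_iff)
      qed
      then show "{x\<in>S. x \<in> L0 \<longleftrightarrow> x \<notin> \<Union>U} \<in> ?F"
        using L0 f g cls by blast
    qed
    show "(\<lambda>L. {C \<in> S // E. \<exists>x\<in>C. x \<in> L0 \<longleftrightarrow> x \<notin> L}) ` ?F \<subseteq> Pow (S // E)" by blast
  qed
  then have "card ?F = card (Pow (S // E))"
    by (rule bij_betw_same_card[symmetric])
  also have "\<dots> = 2 ^ num_classes S ?R"
    using assms(1) by (simp add: card_Pow quotient_def num_classes_conn E_def)
  finally show ?thesis .
qed

section \<open>The three ways to match four points at the ends of two paths\<close>

lemma graph_Un: "graph (A \<union> B) f = graph A f \<union> graph B f"
  by (simp add: graph_def image_Un)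

text \<open>Read \<open>E\<close> as containing two separate paths, from \<open>p\<close> to
  \<open>p'\<close> and from \<open>q\<close> to \<open>q'\<close>. Closing each path on itself
  merges nothing. Joining the paths merges their classes with the first pair, after which the second
  pair adds nothing.\<close>

lemma num_classes_pairs:
  assumes fin: "finite P" and mem: "p \<in> P" "p' \<in> P" "q \<in> P" "q' \<in> P"
    and pp: "(p, p') \<in> conn E" and qq: "(q, q') \<in> conn E" and pq: "(p, q) \<notin> conn E"
  shows "num_classes P (insert (p, p') (insert (q, q') E)) = num_classes P E"
    and "Suc (num_classes P (insert (p, q) (insert (p', q') E))) = num_classes P E"
    and "Suc (num_classes P (insert (p, q') (insert (p', q) E))) = num_classes P E"
    and "(p, q) \<notin> conn (insert (p, p') (insert (q, q') E))"
proof -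
  have pq': "(p', q') \<notin> conn E" "(p', q) \<notin> conn E"
    using pp qq pq by (meson conn_sym conn_trans)+
  show "num_classes P (insert (p, p') (insert (q, q') E)) = num_classes P E"
    using pp qq by (subst num_classes_insert_same; simp add: num_classes_insert_same conn_insert)
  have "(p, q) \<in> conn (insert (p', q') E)" "(p, q') \<in> conn (insert (p', q) E)"
    using pp qq by (auto simp: conn_insert dest: conn_sym)
  then show "Suc (num_classes P (insert (p, q) (insert (p', q') E))) = num_classes P E"
    "Suc (num_classes P (insert (p, q') (insert (p', q) E))) = num_classes P E"
    using num_classes_insert[OF fin mem(2) mem(4) pq'(1)] num_classes_insert[OF fin mem(2) mem(3) pq'(2)]
    by (simp_all add: num_classes_insert_same)
  show "(p, q) \<notin> conn (insert (p, p') (insert (q, q') E))"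
    using pp qq pq by (simp add: conn_insert) (meson conn_sym conn_trans)
qed

text \<open>Parity: \<open>K\<close> matches the class of \<open>q\<close> within itself, so its
  size is even. If \<open>q\<close> were its only member in \<open>Q\<close>, then
  \<open>\<rho>\<close> would match all the rest and the size would be odd.\<close>

lemma ex_partner:
  assumes "finite P" and K: "fpf P K" and \<rho>: "fpf (P - Q) \<rho>" and Q: "Q \<subseteq> P" and q: "q \<in> Q"
  shows "\<exists>q'\<in>Q. q' \<noteq> q \<and> (q, q') \<in> conn (graph P K \<union> graph (P - Q) \<rho>)"
proof (rule ccontr)
  let ?E = "graph P K \<union> graph (P - Q) \<rho>"
  assume *: "\<not> ?thesis"
  define C where "C = {x\<in>P. (q, x) \<in> conn ?E}"
  have qC: "q \<in> C" and CQ: "C \<inter> Q = {q}" and CP: "C \<subseteq> P"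
    using q Q * by (auto simp: C_def)
  have "(x, K x) \<in> conn ?E" if "x \<in> P" for x
    using that subset_conn[of ?E] by (auto simp: graph_def)
  then have "fpf C K"
    using K by (auto simp: fpf_def C_def intro: conn_trans)
  moreover have "(x, \<rho> x) \<in> conn ?E" if "x \<in> P - Q" for x
    using that subset_conn[of ?E] by (auto simp: graph_def)
  then have "fpf (C - {q}) \<rho>"
    using \<rho> CQ by (auto simp: fpf_def C_def intro: conn_trans)
  moreover have finC: "finite C"
    using CP assms(1) by (rule finite_subset)
  ultimately have "even (card C)" "even (card (C - {q}))"
    using even_card_fpf[of C K] even_card_fpf[of "C - {q}" \<rho>] by auto
  moreover have "card C = Suc (card (C - {q}))"
    using finC qC by (rule card.remove)
  ultimately show False by simp
qed

text \<open>Separates the four exceptional points from the rest, so that three different matchings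
  can be compared over one common relation. One direction of each pair suffices, since
  \<open>conn\<close> symmetrises.\<close>

lemma conn_graph_match:
  assumes "\<rho> a = a'" "\<rho> a' = a" "\<rho> b = b'" "\<rho> b' = b" and "{a, a', b, b'} \<subseteq> P"
    and "\<And>x. x \<in> P - {a, a', b, b'} \<Longrightarrow> \<rho> x = \<sigma> x"
  shows "conn (graph P K \<union> graph P \<rho>) =
    conn (insert (a, a') (insert (b, b') (graph P K \<union> graph (P - {a, a', b, b'}) \<sigma>)))"
proof -
  let ?Q = "{a, a', b, b'}"
  have "P = (P - ?Q) \<union> ?Q" using assms(5) by blast
  then have "graph P \<rho> = graph (P - ?Q) \<rho> \<union> graph ?Q \<rho>"
    by (metis graph_Un)
  also have "graph (P - ?Q) \<rho> = graph (P - ?Q) \<sigma>"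
    unfolding graph_def using assms(6) by (intro image_cong) auto
  also have "graph ?Q \<rho> = {(a, a'), (a', a), (b, b'), (b', b)}"
    using assms(1-4) by (simp add: graph_def)
  finally have *: "graph P \<rho> = graph (P - ?Q) \<sigma> \<union> {(a, a'), (a', a), (b, b'), (b', b)}" .
  let ?R = "insert (a, a') (insert (b, b') (graph P K \<union> graph (P - {a, a', b, b'}) \<sigma>))"
  show ?thesis
    unfolding * using subset_conn[of ?R] conn_sym[of _ _ ?R] subset_conn[of "graph P K \<union> graph P \<rho>"] *
    by (intro conn_eqI) auto
qed

text \<open>
  Two paths of the graph formed by \<open>K\<close> and the common part of the three matchings end at the
  four exceptional points. The matching that pairs the ends of each path closes up two cycles,
  the other two matchings close up one.
\<close>

lemma three_matchings:
  assumes fin: "finite P" and K: "fpf P K"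
    and \<rho>: "fpf P \<rho>1" "fpf P \<rho>2" "fpf P \<rho>3"
    and Q: "{a, a', b, b'} \<subseteq> P" "distinct [a, a', b, b']"
    and r1: "\<rho>1 a = a'" "\<rho>1 b = b'"
    and r2: "\<rho>2 a = b" "\<rho>2 a' = b'"
    and r3: "\<rho>3 a = b'" "\<rho>3 a' = b"
    and eq: "\<And>x. x \<in> P - {a, a', b, b'} \<Longrightarrow> \<rho>2 x = \<rho>1 x \<and> \<rho>3 x = \<rho>1 x"
  shows "(a, b) \<notin> conn (graph P K \<union> graph P \<rho>1) \<Longrightarrow>
      Suc (num_classes P (graph P K \<union> graph P \<rho>2)) = num_classes P (graph P K \<union> graph P \<rho>1) \<and>
      Suc (num_classes P (graph P K \<union> graph P \<rho>3)) = num_classes P (graph P K \<union> graph P \<rho>1)"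
    and "(a, b) \<in> conn (graph P K \<union> graph P \<rho>1) \<Longrightarrow>
      num_classes P (graph P K \<union> graph P \<rho>3) = num_classes P (graph P K \<union> graph P \<rho>1) \<longleftrightarrow>
      num_classes P (graph P K \<union> graph P \<rho>2) \<noteq> num_classes P (graph P K \<union> graph P \<rho>1)"
proof -
  let ?Q = "{a, a', b, b'}"
  define E where "E = graph P K \<union> graph (P - ?Q) \<rho>1"
  have inv: "\<rho>1 a' = a" "\<rho>1 b' = b" "\<rho>2 b = a" "\<rho>2 b' = a'" "\<rho>3 b' = a" "\<rho>3 b = a'"
    using \<rho> r1 r2 r3 Q(1) by (auto simp: fpf_def)
  have c1: "conn (graph P K \<union> graph P \<rho>1) = conn (insert (a, a') (insert (b, b') E))"
    unfolding E_def by (rule conn_graph_match) (use r1 inv Q in auto)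
  have Q2: "?Q = {a, b, a', b'}" and Q3: "?Q = {a, b', a', b}" by auto
  have c2: "conn (graph P K \<union> graph P \<rho>2) = conn (insert (a, b) (insert (a', b') E))"
    unfolding E_def Q2 by (rule conn_graph_match) (use r2 inv Q eq in auto)
  have c3: "conn (graph P K \<union> graph P \<rho>3) = conn (insert (a, b') (insert (a', b) E))"
    unfolding E_def Q3 by (rule conn_graph_match) (use r3 inv Q eq in auto)
  note nc = num_classes_cong[OF c1] num_classes_cong[OF c2] num_classes_cong[OF c3]
  have "fpf (P - ?Q) \<rho>1"
    unfolding fpf_def
  proof
    fix x assume x: "x \<in> P - ?Q"
    then have "\<rho>1 x \<in> P" "\<rho>1 (\<rho>1 x) = x" "\<rho>1 x \<noteq> x"
      using \<rho>(1) by (auto simp: fpf_def)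
    moreover from this have "\<rho>1 x \<notin> ?Q"
      using x r1 inv by auto
    ultimately show "\<rho>1 x \<in> P - ?Q \<and> \<rho>1 (\<rho>1 x) = x \<and> \<rho>1 x \<noteq> x" by simp
  qed
  then have partner: "\<exists>q'\<in>?Q. q' \<noteq> q \<and> (q, q') \<in> conn E" if "q \<in> ?Q" for q
    unfolding E_def using ex_partner[OF fin K _ Q(1) that] by blast
  obtain L1 where L1: "flipped P K L1" "flipped P \<rho>1 L1"
    using ex_flipped[OF fin K \<rho>(1)] by blast
  obtain L2 where L2: "flipped P K L2" "flipped P \<rho>2 L2"
    using ex_flipped[OF fin K \<rho>(2)] by blast
  obtain L3 where L3: "flipped P K L3" "flipped P \<rho>3 L3"
    using ex_flipped[OF fin K \<rho>(3)] by blast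
  have flip_E: "(u \<in> L1 \<longleftrightarrow> v \<notin> L1) \<and> (u \<in> L2 \<longleftrightarrow> v \<notin> L2) \<and> (u \<in> L3 \<longleftrightarrow> v \<notin> L3)" if uv: "(u, v) \<in> E" for u v
  proof -
    from uv consider "u \<in> P" "v = K u" | "u \<in> P - ?Q" "v = \<rho>1 u" "v = \<rho>2 u" "v = \<rho>3 u"
      using eq by (auto simp: E_def graph_def)
    then show ?thesis
      using L1 L2 L3 unfolding flipped_def by cases (metis DiffD1)+
  qed
  \<comment> \<open>The colourings agree up to complement on a class, so a class containing all four points
    would carry three pairwise differently coloured points.\<close>
  have not_all: "\<not> ((a, a') \<in> conn E \<and> (a, b) \<in> conn E \<and> (a, b') \<in> conn E)"
  proof
    assume *: "(a, a') \<in> conn E \<and> (a, b) \<in> conn E \<and> (a, b') \<in> conn E"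
    have "a \<in> L1 \<longleftrightarrow> a' \<notin> L1" "a \<in> L2 \<longleftrightarrow> b \<notin> L2" "a' \<in> L3 \<longleftrightarrow> b \<notin> L3"
      using L1 L2 L3 Q(1) r1 r2 r3 unfolding flipped_def by force+
    moreover have "(a \<in> L1 \<longleftrightarrow> a \<in> L2) \<longleftrightarrow> (y \<in> L1 \<longleftrightarrow> y \<in> L2)"
      "(a \<in> L1 \<longleftrightarrow> a \<in> L3) \<longleftrightarrow> (y \<in> L1 \<longleftrightarrow> y \<in> L3)" if "(a, y) \<in> conn E" for y
      using flip_E by (intro flipped_agree[OF _ that]; blast)+
    ultimately show False using * by blast
  qed
  have sym: "(x, y) \<in> conn E \<longleftrightarrow> (y, x) \<in> conn E" for x y
    by (blast intro: conn_sym)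
  have tr: "(x, y) \<in> conn E \<Longrightarrow> (y, z) \<in> conn E \<Longrightarrow> (x, z) \<in> conn E" for x y z
    by (rule conn_trans)
  have pa: "(a, a') \<in> conn E \<or> (a, b) \<in> conn E \<or> (a, b') \<in> conn E"
    "(a, a') \<in> conn E \<or> (a', b) \<in> conn E \<or> (a', b') \<in> conn E"
    "(a, b) \<in> conn E \<or> (a', b) \<in> conn E \<or> (b, b') \<in> conn E"
    "(a, b') \<in> conn E \<or> (a', b') \<in> conn E \<or> (b, b') \<in> conn E"
    using partner[of a] partner[of a'] partner[of b] partner[of b'] by (auto simp: sym)
  have swap: "num_classes P (insert x (insert (u, v) E)) = num_classes P (insert x (insert (v, u) E))" for x u v
    using subset_conn[of "insert x (insert (u, v) E)"] subset_conn[of "insert x (insert (v, u) E)"]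
    by (intro num_classes_cong conn_eqI) (auto intro: conn_sym)
  \<comment> \<open>Each of the four points has a partner in its class and the class never contains
    all four, so the classes split them into two pairs: three possibilities.\<close>
  consider
      "(a, a') \<in> conn E" "(b, b') \<in> conn E" "(a, b) \<notin> conn E"
    | "(a, b) \<in> conn E" "(a', b') \<in> conn E" "(a, a') \<notin> conn E"
    | "(a, b') \<in> conn E" "(a', b) \<in> conn E" "(a, a') \<notin> conn E"
    using pa not_all sym tr by metis
  then have *: "((a, b) \<notin> conn (insert (a, a') (insert (b, b') E)) \<longrightarrow>
      Suc (num_classes P (insert (a, b) (insert (a', b') E))) = num_classes P (insert (a, a') (insert (b, b') E)) \<and>
      Suc (num_classes P (insert (a, b') (insert (a', b) E))) = num_classes P (insert (a, a') (insert (b, b') E))) \<and>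
    ((a, b) \<in> conn (insert (a, a') (insert (b, b') E)) \<longrightarrow>
      (num_classes P (insert (a, b') (insert (a', b) E)) = num_classes P (insert (a, a') (insert (b, b') E)) \<longleftrightarrow>
      num_classes P (insert (a, b) (insert (a', b') E)) \<noteq> num_classes P (insert (a, a') (insert (b, b') E))))"
  proof cases
    case 1
    have "(a, b) \<notin> conn (insert (a, a') (insert (b, b') E))"
      using num_classes_pairs(4)[OF fin _ _ _ _ 1] Q(1) by simp
    moreover note num_classes_pairs(1-3)[OF fin _ _ _ _ 1]
    ultimately show ?thesis
      using Q(1) by simp
  next
    case 2
    then have "(a, b) \<in> conn (insert (a, a') (insert (b, b') E))"
      by (simp add: conn_insert)
    moreover note num_classes_pairs(1-3)[OF fin _ _ _ _ 2]
    ultimately show ?thesis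
      using Q(1) swap[of _ a' b] swap[of _ b' b] swap[of _ b' a'] by simp
  next
    case 3
    then have "(a, b) \<in> conn (insert (a, a') (insert (b, b') E))"
      by (auto simp: conn_insert sym)
    moreover note num_classes_pairs(1-3)[OF fin _ _ _ _ 3]
    ultimately show ?thesis
      using Q(1) swap[of _ a' b] swap[of _ b' b] swap[of _ b' a'] by simp
  qed
  show "(a, b) \<notin> conn (graph P K \<union> graph P \<rho>1) \<Longrightarrow>
      Suc (num_classes P (graph P K \<union> graph P \<rho>2)) = num_classes P (graph P K \<union> graph P \<rho>1) \<and>
      Suc (num_classes P (graph P K \<union> graph P \<rho>3)) = num_classes P (graph P K \<union> graph P \<rho>1)"
    "(a, b) \<in> conn (graph P K \<union> graph P \<rho>1) \<Longrightarrow>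
      num_classes P (graph P K \<union> graph P \<rho>3) = num_classes P (graph P K \<union> graph P \<rho>1) \<longleftrightarrow>
      num_classes P (graph P K \<union> graph P \<rho>2) \<noteq> num_classes P (graph P K \<union> graph P \<rho>1)"
    unfolding nc c1 using * by blast+
qed

section \<open>Twisting the edges of a map\<close>

fun other :: "colour \<Rightarrow> colour" where
  "other White = Black"
| "other Black = White"

lemma other_other [simp]: "other (other c) = c" and other_neq [simp]: "other c \<noteq> c"
  by (cases c; simp)+

lemma UNIV_colour: "UNIV = {White, Black}"
  by (auto intro: colour.exhaust)

text \<open>
  \<open>twist M D\<close> gives a half-twist to the ribbons of the edges in \<open>D\<close>, by exchanging the names
  of their two sides at the black end only.
\<close>

definition swap :: "'a bmap \<Rightarrow> 'a set set \<Rightarrow> 'a \<Rightarrow> 'a" where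
  "swap M D x = (if {x, opp M x} \<in> D then opp M x else x)"

definition twist :: "'a bmap \<Rightarrow> 'a set set \<Rightarrow> 'a bmap" where
  "twist M D = M\<lparr>bcor := swap M D \<circ> bcor M \<circ> swap M D\<rparr>"

fun cor :: "'a bmap \<Rightarrow> 'a \<times> colour \<Rightarrow> 'a \<times> colour" where
  "cor M (x, White) = (wcor M x, White)"
| "cor M (x, Black) = (bcor M x, Black)"

text \<open>
  \<open>rib M D X\<close> matches the ends of edge sides along the boundary of the vertex discs together
  with the ribbons on \<open>X\<close>, those of the edges in \<open>D\<close> being twisted: an end is followed along
  its ribbon if this ribbon is present, and along the attaching arc otherwise.
\<close>

definition rib :: "'a bmap \<Rightarrow> 'a set set \<Rightarrow> 'a set \<Rightarrow> 'a \<times> colour \<Rightarrow> 'a \<times> colour" where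
  "rib M D X = (\<lambda>(y, c). if y \<in> X then (swap M D y, other c) else (opp M y, c))"

lemma twist_simps [simp]:
  "sides (twist M D) = sides M" "opp (twist M D) = opp M" "wcor (twist M D) = wcor M"
  "bcor (twist M D) = swap M D \<circ> bcor M \<circ> swap M D"
  "edges (twist M D) = edges M" "points (twist M D) = points M"
  by (simp_all add: twist_def edges_def points_def)

text \<open>No set of twists occurs, since twisting does not affect connectivity
  (\<open>num_components_twist\<close>).\<close>

definition comp_rel :: "'a bmap \<Rightarrow> 'a set \<Rightarrow> (('a \<times> colour) \<times> ('a \<times> colour)) set" where
  "comp_rel M X = corner_arcs M \<union> ribbon_sides X \<union> attaching_arcs M (sides M)"

text \<open>The boundary of the twisted ribbon graph, but in the labelling of the untwisted map and
  as a union of two matchings, the form that \<open>card_flipped\<close> and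
  \<open>three_matchings\<close> require. \<open>num_faces_twist\<close> justifies it.\<close>

definition face_rel :: "'a bmap \<Rightarrow> 'a set set \<Rightarrow> 'a set \<Rightarrow> (('a \<times> colour) \<times> ('a \<times> colour)) set" where
  "face_rel M D X = graph (points M) (cor M) \<union> graph (points M) (rib M D X)"

text \<open>Connectedness is kept apart; it enters as the hypothesis \<open>nc S = 1\<close> where
  it is used.\<close>

locale ribbon_graph =
  fixes M :: "'a bmap"
  assumes finite_sides: "finite (sides M)"
    and inv_opp: "fpf_involution_on (sides M) (opp M)"
    and inv_wcor: "fpf_involution_on (sides M) (wcor M)"
    and inv_bcor: "fpf_involution_on (sides M) (bcor M)"
begin

abbreviation "S \<equiv> sides M"
abbreviation "P \<equiv> points M"
abbreviation "nf D X \<equiv> num_classes P (face_rel M D X)"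
abbreviation "nc X \<equiv> num_classes P (comp_rel M X)"

text \<open>Off the sides \<open>opp M\<close> is the identity, so the rule needs no membership
  condition.\<close>

lemma opp_opp [simp]: "opp M (opp M x) = x"
  using inv_opp by (cases "x \<in> S") (auto simp: fpf_involution_on_def permutes_def)

lemma opp_in [simp]: "opp M x \<in> S \<longleftrightarrow> x \<in> S"
  using inv_opp by (auto simp: fpf_involution_on_def permutes_in_image)

lemma opp_neq: "x \<in> S \<Longrightarrow> opp M x \<noteq> x"
  using inv_opp by (auto simp: fpf_involution_on_def)

lemma opp_edge [simp]: "{opp M x, x} = {x, opp M x}"
  by auto

lemma swap_swap [simp]: "swap M D (swap M D x) = x"
  by (simp add: swap_def)

lemma opp_swap: "opp M (swap M D x) = swap M D (opp M x)"
  by (simp add: swap_def)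

lemma swap_in [simp]: "swap M D x \<in> S \<longleftrightarrow> x \<in> S"
  by (simp add: swap_def)

lemma swap_notin: "x \<notin> S \<Longrightarrow> swap M D x = x"
  using inv_opp by (simp add: swap_def fpf_involution_on_def permutes_def)

lemma fpf_invo: "fpf_involution_on S f \<Longrightarrow> fpf S f"
  unfolding fpf_involution_on_def fpf_def by (meson permutes_in_image)

lemma finite_points: "finite P"
  using finite_sides by (simp add: points_def UNIV_colour)

lemma fpf_cor: "fpf P (cor M)"
  unfolding fpf_def
proof
  fix p assume "p \<in> P"
  moreover obtain y c where "p = (y, c)" by (cases p)
  ultimately show "cor M p \<in> P \<and> cor M (cor M p) = p \<and> cor M p \<noteq> p"
    using fpf_invo[OF inv_wcor] fpf_invo[OF inv_bcor]
    by (cases c) (auto simp: fpf_def points_def)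
qed

lemma swap_closed:
  assumes "\<And>x. x \<in> X \<Longrightarrow> opp M x \<in> X"
  shows "swap M D x \<in> X \<longleftrightarrow> x \<in> X"
  using assms[of x] assms[of "opp M x"] by (auto simp: swap_def)

lemma fpf_rib:
  assumes "X \<subseteq> S" "\<And>x. x \<in> X \<Longrightarrow> opp M x \<in> X"
  shows "fpf P (rib M D X)"
  unfolding fpf_def
proof
  fix p assume p: "p \<in> P"
  obtain y c where yc: "p = (y, c)" by (cases p)
  then have y: "y \<in> S" using p by (simp add: points_def)
  have "opp M y \<in> X \<longleftrightarrow> y \<in> X"
    using assms(2)[of y] assms(2)[of "opp M y"] by auto
  then show "rib M D X p \<in> P \<and> rib M D X (rib M D X p) = p \<and> rib M D X p \<noteq> p"
    using y swap_closed[OF assms(2), of D y] opp_neq[OF y]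
    by (auto simp: yc rib_def points_def)
qed

lemma face_relI: "p \<in> P \<Longrightarrow> (p, cor M p) \<in> face_rel M D X" "p \<in> P \<Longrightarrow> (p, rib M D X p) \<in> face_rel M D X"
  by (auto simp: face_rel_def graph_def)

text \<open>Undoes the renaming made by \<open>twist\<close> at the black ends: the corners of
  \<open>twist M D\<close> become those of \<open>M\<close>, and the twist reappears in the ribbon
  sides (\<open>image_corner\<close>, \<open>image_ribbon\<close>).\<close>

definition black_swap :: "'a set set \<Rightarrow> 'a \<times> colour \<Rightarrow> 'a \<times> colour" where
  "black_swap D = (\<lambda>(x, c). if c = White then (x, c) else (swap M D x, c))"

lemma black_swap_black_swap [simp]: "black_swap D (black_swap D p) = p"
  by (auto simp: black_swap_def split: prod.split)

lemma black_swap_points: "black_swap D ` P = P"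
proof -
  have *: "black_swap D p \<in> P" if "p \<in> P" for p
    using that by (auto simp: black_swap_def points_def split: prod.split)
  then show ?thesis by (metis (no_types, lifting) black_swap_black_swap image_subsetI imageI subsetI subset_antisym)
qed

lemma num_classes_black_swap:
  assumes "R \<subseteq> P \<times> P" "conn (map_prod (black_swap D) (black_swap D) ` R) = conn R'"
  shows "num_classes P R = num_classes P R'"
proof -
  have "inj_on (black_swap D) P" by (metis black_swap_black_swap inj_onI)
  then have "num_classes P R = num_classes (black_swap D ` P) (map_prod (black_swap D) (black_swap D) ` R)"
    using assms(1) by (rule num_classes_image[symmetric])
  also have "\<dots> = num_classes P R'"
    unfolding black_swap_points by (rule num_classes_cong) fact
  finally show ?thesis .
qed

lemma wcor_in: "x \<in> S \<Longrightarrow> wcor M x \<in> S" and bcor_in: "x \<in> S \<Longrightarrow> bcor M x \<in> S"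
  using fpf_invo[OF inv_wcor] fpf_invo[OF inv_bcor] by (auto simp: fpf_def)

lemma image_corner: "map_prod (black_swap D) (black_swap D) ` corner_arcs (twist M D) = corner_arcs M"
proof
  show "map_prod (black_swap D) (black_swap D) ` corner_arcs (twist M D) \<subseteq> corner_arcs M"
    by (auto simp: corner_arcs_def black_swap_def)
  have "((x, Black), (bcor M x, Black)) \<in> map_prod (black_swap D) (black_swap D) ` corner_arcs (twist M D)" if "x \<in> S" for x
    by (rule image_eqI[where x = "((swap M D x, Black), (swap M D (bcor M x), Black))"])
      (use that in \<open>auto simp: corner_arcs_def black_swap_def\<close>)
  moreover have "((x, White), (wcor M x, White)) \<in> map_prod (black_swap D) (black_swap D) ` corner_arcs (twist M D)" if "x \<in> S" for x
    by (rule image_eqI[where x = "((x, White), (wcor M x, White))"])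
      (use that in \<open>auto simp: corner_arcs_def black_swap_def\<close>)
  ultimately show "corner_arcs M \<subseteq> map_prod (black_swap D) (black_swap D) ` corner_arcs (twist M D)"
    by (auto simp: corner_arcs_def)
qed

lemma image_ribbon:
  "map_prod (black_swap D) (black_swap D) ` ribbon_sides X = {((x, White), (swap M D x, Black)) | x. x \<in> X}"
  by (force simp: ribbon_sides_def black_swap_def)

lemma image_attaching:
  assumes "\<And>x. x \<in> X \<Longrightarrow> opp M x \<in> X"
  shows "map_prod (black_swap D) (black_swap D) ` attaching_arcs (twist M D) X = attaching_arcs M X"
proof
  note cl = swap_closed[of X, OF assms]
  show "map_prod (black_swap D) (black_swap D) ` attaching_arcs (twist M D) X \<subseteq> attaching_arcs M X"
    by (auto simp: attaching_arcs_def black_swap_def cl opp_swap)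
  have "((x, c), (opp M x, c)) \<in> map_prod (black_swap D) (black_swap D) ` attaching_arcs (twist M D) X" if "x \<in> X" for x c
    by (rule image_eqI[where x = "(black_swap D (x, c), black_swap D (opp M x, c))"])
      (use that in \<open>auto simp: attaching_arcs_def black_swap_def cl opp_swap\<close>)
  then show "attaching_arcs M X \<subseteq> map_prod (black_swap D) (black_swap D) ` attaching_arcs (twist M D) X"
    by (auto simp: attaching_arcs_def)
qed

lemma Union_edges: "F \<subseteq> edges M \<Longrightarrow> x \<in> \<Union>F \<longleftrightarrow> {x, opp M x} \<in> F"
  by (auto simp: edges_def)

lemma edges_opp: "F \<subseteq> edges M \<Longrightarrow> x \<in> \<Union>F \<Longrightarrow> opp M x \<in> \<Union>F"
  using Union_edges[of F x] Union_edges[of F "opp M x"] by simp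

lemma Union_edges_subset: "F \<subseteq> edges M \<Longrightarrow> \<Union>F \<subseteq> S"
  by (auto simp: edges_def)

lemma num_faces_twist:
  assumes F: "F \<subseteq> edges M"
  shows "num_faces_without (twist M D) F = nf D (S - \<Union>F)"
proof -
  let ?X = "S - \<Union>F"
  let ?R = "corner_arcs (twist M D) \<union> ribbon_sides ?X \<union> attaching_arcs (twist M D) (\<Union>F)"
  note FS = Union_edges_subset[OF F] and opF = edges_opp[OF F]
  have X: "opp M x \<in> ?X" if "x \<in> ?X" for x
    using that opF[of "opp M x"] by auto
  have R: "?R \<subseteq> P \<times> P"
    using FS by (auto simp: corner_arcs_def ribbon_sides_def attaching_arcs_def points_def wcor_in bcor_in)
  let ?I = "map_prod (black_swap D) (black_swap D) ` ?R"
  have I: "?I = corner_arcs M \<union> {((x, White), (swap M D x, Black)) | x. x \<in> ?X} \<union> attaching_arcs M (\<Union>F)"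
    by (simp only: image_Un image_corner image_ribbon image_attaching[OF opF])
  have "conn ?I = conn (face_rel M D ?X)"
  proof (rule conn_eqI)
    have "?I \<subseteq> face_rel M D ?X"
    proof
      fix u assume "u \<in> ?I"
      from this[unfolded I] consider x where "x \<in> S" "u = ((x, White), (wcor M x, White))"
        | x where "x \<in> S" "u = ((x, Black), (bcor M x, Black))"
        | x where "x \<in> ?X" "u = ((x, White), (swap M D x, Black))"
        | x c where "x \<in> \<Union>F" "u = ((x, c), (opp M x, c))"
        unfolding corner_arcs_def attaching_arcs_def by blast
      then show "u \<in> face_rel M D ?X"
      proof cases
        case (1 x)
        then show ?thesis using face_relI(1)[of "(x, White)"] by (simp add: points_def)
      next
        case (2 x)
        then show ?thesis using face_relI(1)[of "(x, Black)"] by (simp add: points_def)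
      next
        case (3 x)
        then show ?thesis using face_relI(2)[of "(x, White)" D ?X] by (simp add: points_def rib_def)
      next
        case (4 x c)
        then have "x \<in> S" "x \<notin> ?X" using FS by auto
        moreover have "((x, c), rib M D ?X (x, c)) \<in> face_rel M D ?X"
          using \<open>x \<in> S\<close> by (intro face_relI(2)) (simp add: points_def)
        ultimately show ?thesis using 4 by (simp only: rib_def prod.case if_False)
      qed
    qed
    then show "?I \<subseteq> conn (face_rel M D ?X)"
      using subset_conn by blast
    show "face_rel M D ?X \<subseteq> conn ?I"
    proof
      fix u assume "u \<in> face_rel M D ?X"
      then consider x where "x \<in> S" "u = ((x, White), (wcor M x, White))"
        | x where "x \<in> S" "u = ((x, Black), (bcor M x, Black))"
        | x where "x \<in> ?X" "u = ((x, White), (swap M D x, Black))"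
        | x where "x \<in> ?X" "u = ((x, Black), (swap M D x, White))"
        | x c where "x \<in> \<Union>F" "u = ((x, c), (opp M x, c))"
        unfolding face_rel_def graph_def points_def rib_def UNIV_colour by (auto split: if_splits)
      then show "u \<in> conn ?I"
      proof cases
        \<comment> \<open>The boundary relation lists each ribbon side from its white end only; the
          step from the black end of \<open>x\<close> is the reverse of the one belonging to
          \<open>swap M D x\<close>.\<close>
        case (4 x)
        then have "swap M D x \<in> ?X"
          using swap_closed[of ?X, OF X] by blast
        then have "((swap M D x, White), (swap M D (swap M D x), Black)) \<in> ?I"
          unfolding I by blast
        then show ?thesis
          using 4 subset_conn[of ?I] conn_sym[of "(swap M D x, White)" "(x, Black)" ?I] by auto
      qed (unfold I, unfold corner_arcs_def attaching_arcs_def, (rule subsetD[OF subset_conn], blast)+)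
    qed
  qed
  then have "num_classes P ?R = nf D ?X"
    by (rule num_classes_black_swap[OF R])
  then show ?thesis
    by (simp add: num_faces_without_def)
qed

text \<open>A twist moves the black end of a ribbon side at most across its attaching arc, and all
  attaching arcs are available in this relation.\<close>

lemma num_components_twist:
  assumes F: "F \<subseteq> edges M"
  shows "num_components_without (twist M D) F = nc (S - \<Union>F)"
proof -
  let ?X = "S - \<Union>F"
  let ?R = "corner_arcs (twist M D) \<union> ribbon_sides ?X \<union> attaching_arcs (twist M D) S"
  have R: "?R \<subseteq> P \<times> P"
    by (auto simp: corner_arcs_def ribbon_sides_def attaching_arcs_def points_def wcor_in bcor_in)
  let ?I = "map_prod (black_swap D) (black_swap D) ` ?R"
  have I: "?I = corner_arcs M \<union> {((x, White), (swap M D x, Black)) | x. x \<in> ?X} \<union> attaching_arcs M S"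
    using image_attaching[of S D] by (simp only: image_Un image_corner image_ribbon) simp
  have swap_conn: "((x, c), (swap M D x, c)) \<in> conn R'" if "x \<in> S" "attaching_arcs M S \<subseteq> R'" for x c R'
    using that subset_conn[of R'] by (auto simp: swap_def attaching_arcs_def)
  have att: "attaching_arcs M S \<subseteq> ?I" "attaching_arcs M S \<subseteq> comp_rel M ?X"
    unfolding I comp_rel_def by auto
  have cor: "corner_arcs M \<subseteq> ?I"
    unfolding I by blast
  have "conn ?I = conn (comp_rel M ?X)"
  proof (rule conn_eqI)
    have "((x, White), (swap M D x, Black)) \<in> conn (comp_rel M ?X)" if x: "x \<in> ?X" for x
    proof (rule conn_trans)
      show "((x, White), (x, Black)) \<in> conn (comp_rel M ?X)"
        using subset_conn[of "comp_rel M ?X"] x by (auto simp: comp_rel_def ribbon_sides_def)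
      show "((x, Black), (swap M D x, Black)) \<in> conn (comp_rel M ?X)"
        using x att by (intro swap_conn) auto
    qed
    then show "?I \<subseteq> conn (comp_rel M ?X)"
      using subset_conn[of "comp_rel M ?X"] unfolding I comp_rel_def by auto
    have "((x, White), (x, Black)) \<in> conn ?I" if x: "x \<in> ?X" for x
    proof (rule conn_trans)
      show "((x, White), (swap M D x, Black)) \<in> conn ?I"
        using subset_conn[of ?I] x unfolding I by auto
      show "((swap M D x, Black), (x, Black)) \<in> conn ?I"
        using x att by (intro conn_sym[OF swap_conn]) auto
    qed
    then show "comp_rel M ?X \<subseteq> conn ?I"
      unfolding comp_rel_def
      by (intro Un_least order_trans[OF cor subset_conn] order_trans[OF att(1) subset_conn])
        (auto simp: ribbon_sides_def)
  qed
  then have "num_classes P ?R = nc ?X"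
    by (rule num_classes_black_swap[OF R])
  then show ?thesis
    by (simp add: num_components_without_def)
qed

end

section \<open>Inserting the edges one by one and counting the admissible twists\<close>

lemma neq_colour [simp]: "c \<noteq> White \<longleftrightarrow> c = Black" "c \<noteq> Black \<longleftrightarrow> c = White"
  by (cases c; simp)+

context ribbon_graph
begin

text \<open>Twists of absent ribbons have no influence, so the choice made for an edge leaves the
  earlier stages untouched.\<close>

lemma face_rel_cong:
  assumes "\<And>x. x \<in> X \<Longrightarrow> {x, opp M x} \<in> D \<longleftrightarrow> {x, opp M x} \<in> D'"
  shows "face_rel M D X = face_rel M D' X"
proof -
  have "rib M D X = rib M D' X"
    using assms by (auto simp: rib_def swap_def fun_eq_iff)
  then show ?thesis by (simp add: face_rel_def)
qed

text \<open>Bare discs have one boundary circle each. This starts the induction in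
  \<open>greedy_count\<close> and is the stage with all edges deleted, which the theorem does not
  ask for.\<close>

lemma num_classes_empty: "nf D {} = nc {}"
proof (rule num_classes_cong, rule conn_eqI)
  let ?F = "face_rel M D {}" and ?C = "comp_rel M {}"
  have "?F = ?C"
    by (auto simp: face_rel_def comp_rel_def graph_def rib_def points_def corner_arcs_def
        ribbon_sides_def attaching_arcs_def image_iff UNIV_colour)
  then show "?F \<subseteq> conn ?C" "?C \<subseteq> conn ?F"
    using subset_conn by auto
qed

lemma conn_comp_opp: "x \<in> S \<Longrightarrow> ((x, c), (opp M x, c)) \<in> conn (comp_rel M X)"
  using subset_conn[of "comp_rel M X"] by (auto simp: comp_rel_def attaching_arcs_def)

lemma conn_face_comp: 
  assumes "X \<subseteq> S"
  shows "conn (face_rel M D X) \<subseteq> conn (comp_rel M X)"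
proof (rule conn_least)
  let ?C = "comp_rel M X"
  have 1: "((x, White), (wcor M x, White)) \<in> conn ?C" "((x, Black), (bcor M x, Black)) \<in> conn ?C"
    if "x \<in> S" for x
    using that subset_conn[of ?C] by (auto simp: comp_rel_def corner_arcs_def)
  have 2: "((x, c), (swap M D x, c)) \<in> conn ?C" if "x \<in> S" for x c
    using that by (simp add: swap_def conn_comp_opp)
  have "((x, White), (x, Black)) \<in> conn ?C" if "x \<in> X" for x
    using that subset_conn[of ?C] by (auto simp: comp_rel_def ribbon_sides_def)
  then have "((x, c), (x, other c)) \<in> conn ?C" if "x \<in> X" for x c
    using that by (cases c) (auto intro: conn_sym)
  then have 3: "((x, c), (swap M D x, other c)) \<in> conn ?C" if "x \<in> X" for x c
    using that assms 2 by (blast intro: conn_trans)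
  show "face_rel M D X \<subseteq> conn ?C"
  proof
    fix u assume "u \<in> face_rel M D X"
    then obtain x c where x: "x \<in> S" "u = ((x, c), cor M (x, c)) \<or> u = ((x, c), rib M D X (x, c))"
      by (auto simp: face_rel_def graph_def points_def)
    then show "u \<in> conn ?C"
      using 1 3[of x White] 3[of x Black] conn_comp_opp[of x c X] by (cases c) (auto simp: rib_def)
  qed
qed

text \<open>Before the insertion \<open>rib\<close> pairs the four ends along the attaching arcs, as
  \<open>?a ?a'\<close> and \<open>?b ?b'\<close>; a plain ribbon pairs \<open>?a ?b\<close> and
  \<open>?a' ?b'\<close>, a twisted one \<open>?a ?b'\<close> and \<open>?a' ?b\<close>. Hence
  \<open>three_matchings\<close> applies. The first alternative is an edge inside a component, the
  second an edge joining two components.\<close>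

lemma greedy_step:
  assumes X: "X \<subseteq> S" "\<And>y. y \<in> X \<Longrightarrow> opp M y \<in> X"
    and x: "x \<in> S" "x \<notin> X" and D: "{x, opp M x} \<notin> D"
    and eq: "nf D X = nc X"
  defines "X' \<equiv> X \<union> {x, opp M x}"
  shows "nc X' = nc X \<and> (nf (insert {x, opp M x} D) X' = nc X' \<longleftrightarrow> nf D X' \<noteq> nc X') \<or>
    Suc (nc X') = nc X \<and> nf D X' = nc X' \<and> nf (insert {x, opp M x} D) X' = nc X'"
proof -
  let ?e = "{x, opp M x}"
  let ?a = "(x, White)" and ?a' = "(opp M x, White)" and ?b = "(x, Black)" and ?b' = "(opp M x, Black)"
  have x': "opp M x \<notin> X" using X(2)[of "opp M x"] x by auto
  have X': "X' \<subseteq> S" "\<And>y. y \<in> X' \<Longrightarrow> opp M y \<in> X'"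
    using X x by (auto simp: X'_def)
  have edge_iff: "{y, opp M y} = ?e \<longleftrightarrow> y \<in> ?e" for y
    by (auto simp: doubleton_eq_iff)
  have in_e: "{y, opp M y} \<notin> D" if "y \<in> ?e" for y
    using that D by auto
  have Q: "{?a, ?a', ?b, ?b'} \<subseteq> P" "distinct [?a, ?a', ?b, ?b']"
    using x(1) opp_neq[OF x(1)] by (auto simp: points_def)
  have r1: "rib M D X ?a = ?a'" "rib M D X ?b = ?b'"
    using x by (simp_all add: rib_def)
  have r2: "rib M D X' ?a = ?b" "rib M D X' ?a' = ?b'"
    using in_e by (simp_all add: rib_def X'_def swap_def)
  have r3: "rib M (insert ?e D) X' ?a = ?b'" "rib M (insert ?e D) X' ?a' = ?b"
    by (simp_all add: rib_def X'_def swap_def)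
  have off: "rib M D X' p = rib M D X p \<and> rib M (insert ?e D) X' p = rib M D X p"
    if "p \<in> P - {?a, ?a', ?b, ?b'}" for p
  proof -
    obtain y c where yc: "p = (y, c)" by (cases p)
    with that have "y \<notin> ?e" by (cases c) auto
    then have "{y, opp M y} \<noteq> ?e" using edge_iff by simp
    with \<open>y \<notin> ?e\<close> show ?thesis
      by (auto simp: yc rib_def X'_def swap_def)
  qed
  note three = three_matchings[OF finite_points fpf_cor fpf_rib[OF X, of D] fpf_rib[OF X', of D]
      fpf_rib[OF X', of "insert ?e D"] Q r1 r2 r3 off, folded face_rel_def]
  \<comment> \<open>By \<open>eq\<close> every component has exactly one face, so the case
    distinction of \<open>three\<close> on faces becomes one on components.\<close>
  have ab: "(?a, ?b) \<in> conn (face_rel M D X) \<longleftrightarrow> (?a, ?b) \<in> conn (comp_rel M X)"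
    using num_classes_mono(2)[OF finite_points conn_face_comp[OF X(1)] eq[symmetric], of ?a ?b]
      conn_face_comp[OF X(1), of D] x by (auto simp: points_def)
  have "conn (comp_rel M X') = conn (insert (?a, ?b) (comp_rel M X))"
  proof (rule conn_eqI)
    have sub: "comp_rel M X \<subseteq> conn (insert (?a, ?b) (comp_rel M X))"
      using subset_conn[of "insert (?a, ?b) (comp_rel M X)"] by blast
    \<comment> \<open>The second side of the ribbon connects nothing new: its ends are joined to
      those of the first side by attaching arcs.\<close>
    have "(?a', ?b') \<in> conn (insert (?a, ?b) (comp_rel M X))"
      using conn_comp_opp[OF x(1)] by (auto simp: conn_insert intro: conn_sym)
    moreover have "comp_rel M X' = insert (?a, ?b) (insert (?a', ?b') (comp_rel M X))"
      by (auto simp: comp_rel_def X'_def ribbon_sides_def)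
    ultimately show "comp_rel M X' \<subseteq> conn (insert (?a, ?b) (comp_rel M X))"
      using sub subset_conn[of "insert (?a, ?b) (comp_rel M X)"] by blast
    show "insert (?a, ?b) (comp_rel M X) \<subseteq> conn (comp_rel M X')"
      using subset_conn[of "comp_rel M X'"] by (auto simp: comp_rel_def X'_def ribbon_sides_def)
  qed
  then have nc': "nc X' = num_classes P (insert (?a, ?b) (comp_rel M X))"
    by (rule num_classes_cong)
  show ?thesis
  proof (cases "(?a, ?b) \<in> conn (comp_rel M X)")
    case True
    then have "nc X' = nc X"
      using nc' num_classes_insert_same by metis
    then show ?thesis
      using three(2) True ab eq by simp
  next
    case False
    moreover have "Suc (nc X') = nc X"
      unfolding nc' using num_classes_insert[OF finite_points _ _ False] x by (simp add: points_def)
    ultimately show ?thesis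
      using three(1) ab eq by simp
  qed
qed

lemma edges_eq: "e \<in> edges M \<Longrightarrow> y \<in> e \<Longrightarrow> e = {y, opp M y}"
  by (auto simp: edges_def)

text \<open>The product is invariant: an edge joining two components doubles the number of
  admissible sets and lowers \<open>nc\<close> by one, an edge inside a component changes
  neither.\<close>

lemma greedy_count:
  fixes n k :: nat
  assumes e: "bij_betw e {..<n} (edges M)" and k: "k \<le> n"
  shows "card {D. D \<subseteq> e ` {..<k} \<and> (\<forall>j\<le>k. nf D (\<Union>(e ` {..<j})) = nc (\<Union>(e ` {..<j})))}
    * 2 ^ nc (\<Union>(e ` {..<k})) = 2 ^ nc {}"
  using k
proof (induction k)
  case 0
  have "{D. D \<subseteq> e ` {..<0} \<and> (\<forall>j\<le>0. nf D (\<Union>(e ` {..<j})) = nc (\<Union>(e ` {..<j})))} = {{}}"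
    using num_classes_empty by auto
  then show ?case by simp
next
  case (Suc k)
  let ?X = "\<lambda>j. \<Union>(e ` {..<j})"
  let ?ok = "\<lambda>D j. nf D (?X j) = nc (?X j)"
  let ?G = "\<lambda>k. {D. D \<subseteq> e ` {..<k} \<and> (\<forall>j\<le>k. ?ok D j)}"
  have F: "e ` {..<j} \<subseteq> edges M" if "j \<le> n" for j
    using e that by (auto simp: bij_betw_def)
  have kn: "k < n" using Suc.prems by simp
  obtain x where x: "x \<in> S" "e k = {x, opp M x}"
    using F[of "Suc k"] kn by (auto simp: edges_def)
  have ek: "e k \<notin> e ` {..<k}"
  proof
    assume "e k \<in> e ` {..<k}"
    then obtain j where "j < k" "e k = e j" by auto
    then show False
      using e kn by (auto simp: bij_betw_def dest: inj_onD[of e _ k j])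
  qed
  have XS: "?X j \<subseteq> S" if "j \<le> n" for j
    using Union_edges_subset[OF F[OF that]] .
  have Xopp: "y \<in> ?X j \<Longrightarrow> opp M y \<in> ?X j" if "j \<le> n" for j y
    using edges_opp[OF F[OF that]] .
  have xX: "x \<notin> ?X k"
    using Union_edges[OF F[of k], of x] kn ek x by simp
  have XSuc: "?X (Suc k) = ?X k \<union> {x, opp M x}"
    using x(2) by (auto simp: lessThan_Suc)
  have loc: "nf (insert (e k) D) (?X j) = nf D (?X j)" if "j \<le> k" for j D
  proof -
    have "{y, opp M y} \<noteq> e k" if "y \<in> ?X j" for y
    proof -
      have "{y, opp M y} \<in> e ` {..<j}"
        using Union_edges[OF F[of j], of y] that \<open>j \<le> k\<close> kn by simp
      moreover have "e ` {..<j} \<subseteq> e ` {..<k}"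
        using \<open>j \<le> k\<close> by (intro image_mono) auto
      ultimately show ?thesis using ek by (metis subsetD)
    qed
    then have "face_rel M (insert (e k) D) (?X j) = face_rel M D (?X j)"
      by (intro face_rel_cong) auto
    then show ?thesis by simp
  qed
  \<comment> \<open>The extensions in which the new edge stays plain, and those in which it is
    twisted.\<close>
  let ?A = "{D \<in> ?G k. ?ok D (Suc k)}" and ?B = "{D \<in> ?G k. ?ok (insert (e k) D) (Suc k)}"
  have G: "?G (Suc k) = ?A \<union> insert (e k) ` ?B"
  proof
    show "?A \<union> insert (e k) ` ?B \<subseteq> ?G (Suc k)"
      using loc by (auto simp: le_Suc_eq lessThan_Suc)
    show "?G (Suc k) \<subseteq> ?A \<union> insert (e k) ` ?B"
    proof
      fix D assume D: "D \<in> ?G (Suc k)"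
      show "D \<in> ?A \<union> insert (e k) ` ?B"
      proof (cases "e k \<in> D")
        case True
        let ?D = "D - {e k}"
        have ins: "D = insert (e k) ?D" using True by blast
        have "?ok ?D j" if "j \<le> k" for j
          using D loc[OF that, of ?D] that ins by auto
        moreover have "?D \<subseteq> e ` {..<k}" "?ok (insert (e k) ?D) (Suc k)"
          using D ins by (auto simp: lessThan_Suc)
        ultimately have "?D \<in> ?B" by simp
        then show ?thesis using ins by blast
      next
        case False
        then have "D \<in> ?A" using D by (auto simp: lessThan_Suc)
        then show ?thesis by blast
      qed
    qed
  qed
  have fin: "finite (?G k)"
    by (rule finite_subset[of _ "Pow (e ` {..<k})"]) auto
  have "card (insert (e k) ` ?B) = card ?B"
    using ek by (intro card_image inj_onI) (blast dest: insert_ident[THEN iffD1, rotated 2])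
  moreover have "?A \<inter> insert (e k) ` ?B = {}"
    using ek by auto
  ultimately have cardG: "card (?G (Suc k)) = card ?A + card ?B"
    unfolding G using fin by (subst card_Un_disjoint) auto
  have step: "nc (?X (Suc k)) = nc (?X k) \<and> (?ok (insert (e k) D) (Suc k) \<longleftrightarrow> \<not> ?ok D (Suc k)) \<or>
    Suc (nc (?X (Suc k))) = nc (?X k) \<and> ?ok D (Suc k) \<and> ?ok (insert (e k) D) (Suc k)"
    if "D \<in> ?G k" for D
  proof -
    have "{x, opp M x} \<notin> D" using that ek x(2) by auto
    moreover have "?ok D k" using that by simp
    ultimately show ?thesis
      unfolding XSuc x(2) using greedy_step[OF XS[of k] Xopp[of k] x(1) xX] kn by simp
  qed
  have IH: "card (?G k) * 2 ^ nc (?X k) = 2 ^ nc {}"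
    using Suc.IH kn by simp
  \<comment> \<open>\<open>step\<close> speaks about an admissible set, so one must exist before the
    change of \<open>nc\<close> can be read off from it.\<close>
  then have "?G k \<noteq> {}" by (metis card.empty mult_is_0 power_not_zero zero_neq_numeral)
  then obtain D0 where D0: "D0 \<in> ?G k" by blast
  show ?case
  proof (cases "nc (?X (Suc k)) = nc (?X k)")
    case True
    then have "?B = ?G k - ?A"
      using step by auto
    moreover have "?A \<subseteq> ?G k" by blast
    ultimately have "card ?A + card ?B = card (?G k)"
      using fin by (metis (no_types, lifting) card_Diff_subset card_mono finite_subset le_add_diff_inverse)
    then show ?thesis
      using IH True cardG by simp
  next
    case False
    then have A: "?A = ?G k" and B: "?B = ?G k"
      using step by auto
    have "card (?G (Suc k)) = 2 * card (?G k)"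
      unfolding cardG A B by (rule mult_2[symmetric])
    moreover have "nc (?X k) = Suc (nc (?X (Suc k)))"
      using False step[OF D0] by simp
    ultimately show ?thesis
      using IH by (simp only: power_Suc ac_simps)
  qed
qed

text \<open>With no ribbons, \<open>rib M {} {}\<close> runs along attaching arcs, so a common
  two-colouring with \<open>cor\<close> orients every vertex disc independently. Its white part is
  \<open>L1\<close>, its black part \<open>L2\<close>, and \<open>nc {}\<close> is the number of
  discs.\<close>

lemma card_disc_orientations:
  "card {(L1, L2). L1 \<subseteq> S \<and> flipped S (opp M) L1 \<and> flipped S (wcor M) L1 \<and>
     L2 \<subseteq> S \<and> flipped S (opp M) L2 \<and> flipped S (bcor M) L2} = 2 ^ nc {}" (is "card ?O = _")
proof -
  let ?F = "{L. L \<subseteq> P \<and> flipped P (cor M) L \<and> flipped P (rib M {} {}) L}"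
  have "bij_betw (\<lambda>(L1, L2). L1 \<times> {White} \<union> L2 \<times> {Black}) ?O ?F"
  proof (rule bij_betw_byWitness[where f' = "\<lambda>L. ({x. (x, White) \<in> L}, {x. (x, Black) \<in> L})"])
    show "\<forall>L\<in>?F. (case ({x. (x, White) \<in> L}, {x. (x, Black) \<in> L}) of
        (L1, L2) \<Rightarrow> L1 \<times> {White} \<union> L2 \<times> {Black}) = L"
    proof
      fix L
      have "(x, c) \<in> {x. (x, White) \<in> L} \<times> {White} \<union> {x. (x, Black) \<in> L} \<times> {Black} \<longleftrightarrow> (x, c) \<in> L" for x c
        by (cases c) auto
      then show "(case ({x. (x, White) \<in> L}, {x. (x, Black) \<in> L}) of
        (L1, L2) \<Rightarrow> L1 \<times> {White} \<union> L2 \<times> {Black}) = L"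
        by (simp add: set_eq_iff del: Un_iff)
    qed
    show "(\<lambda>(L1, L2). L1 \<times> {White} \<union> L2 \<times> {Black}) ` ?O \<subseteq> ?F"
      by (auto simp: points_def flipped_def UNIV_colour rib_def)
    show "(\<lambda>L. ({x. (x, White) \<in> L}, {x. (x, Black) \<in> L})) ` ?F \<subseteq> ?O"
      by (auto simp: points_def flipped_def UNIV_colour rib_def)
  qed auto
  then have "card ?O = card ?F" by (rule bij_betw_same_card)
  also have "\<dots> = 2 ^ nf {} {}"
    unfolding face_rel_def by (rule card_flipped[OF finite_points fpf_cor fpf_rib]) auto
  finally show ?thesis by (simp add: num_classes_empty)
qed

end

section \<open>Counting labelled maps\<close>

text \<open>The order is reflexive, so an element counts itself and ranks start at 1, in accordance
  with \<open>first_edges\<close>.\<close>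

lemma linear_order_rank:
  assumes "finite A" and r: "linear_order_on A r"
  shows "bij_betw (\<lambda>a. card {b \<in> A. (b, a) \<in> r}) A {1..card A}"
proof -
  let ?rk = "\<lambda>a. card {b \<in> A. (b, a) \<in> r}"
  have refl: "\<And>a. a \<in> A \<Longrightarrow> (a, a) \<in> r" and tr: "trans r" and anti: "antisym r"
    and tot: "\<And>a b. a \<in> A \<Longrightarrow> b \<in> A \<Longrightarrow> a \<noteq> b \<Longrightarrow> (a, b) \<in> r \<or> (b, a) \<in> r"
    using r by (auto simp: order_on_defs refl_on_def total_on_def)
  have less: "?rk a < ?rk b" if "(a, b) \<in> r" "a \<noteq> b" "a \<in> A" "b \<in> A" for a b
  proof (rule psubset_card_mono)
    have "b \<in> {x \<in> A. (x, b) \<in> r} - {x \<in> A. (x, a) \<in> r}"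
      using that refl antisymD[OF anti] by auto
    moreover have "{x \<in> A. (x, a) \<in> r} \<subseteq> {x \<in> A. (x, b) \<in> r}"
      using that transD[OF tr] by blast
    ultimately show "{x \<in> A. (x, a) \<in> r} \<subset> {x \<in> A. (x, b) \<in> r}" by blast
  qed (use assms in simp)
  have inj: "inj_on ?rk A"
  proof (rule inj_onI, rule ccontr)
    fix a b assume "a \<in> A" "b \<in> A" "?rk a = ?rk b" "a \<noteq> b"
    then show False using tot[of a b] less[of a b] less[of b a] by auto
  qed
  have "?rk ` A \<subseteq> {1..card A}"
  proof (rule image_subsetI)
    fix a assume "a \<in> A"
    then have "card {a} \<le> ?rk a"
      using assms(1) refl by (intro card_mono) auto
    moreover have "?rk a \<le> card A"
      using assms(1) by (intro card_mono) auto
    ultimately show "?rk a \<in> {1..card A}" by simp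
  qed
  then have "?rk ` A = {1..card A}"
    using inj by (intro card_subset_eq) (auto simp: card_image)
  with inj show ?thesis by (simp add: bij_betw_def)
qed

definition good :: "'a bmap \<Rightarrow> ('a set \<times> 'a set) set \<Rightarrow> bool" where
  "good M r \<longleftrightarrow> num_faces M = 1 \<and> (\<forall>i. 1 \<le> i \<and> i < card (edges M) \<longrightarrow>
     num_components_without M (first_edges M r i) = num_faces_without M (first_edges M r i))"

lemma is_map_iff: "is_map M \<longleftrightarrow> ribbon_graph M \<and> num_classes (points M) (comp_rel M (sides M)) = 1"
  by (simp add: is_map_def ribbon_graph_def num_components_without_def comp_rel_def conj_ac)

lemma first_edges_twist [simp]: "first_edges (twist M D) r i = first_edges M r i"
  by (simp add: first_edges_def)

lemma swap_twist [simp]: "swap (twist M D) D' = swap M D'"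
  by (simp add: swap_def fun_eq_iff)

context ribbon_graph
begin

lemma finite_edges: "finite (edges M)"
proof -
  have "edges M = (\<lambda>x. {x, opp M x}) ` S" by (auto simp: edges_def)
  then show ?thesis using finite_sides by simp
qed

lemma Union_edges_all: "\<Union>(edges M) = S"
  by (auto simp: edges_def)

lemma card_edges: "2 * card (edges M) = card S"
proof -
  have "2 * card (edges M) = card (\<Union>(edges M))"
  proof (rule card_partition)
    show "finite (\<Union>(edges M))" using finite_sides by (simp add: Union_edges_all)
    show "card e = 2" if "e \<in> edges M" for e
      using that opp_neq by (auto simp: edges_def) (metis card_2_iff)
    show "e \<inter> e' = {}" if "e \<in> edges M" "e' \<in> edges M" "e \<noteq> e'" for e e'
      using edges_eq[OF that(1)] edges_eq[OF that(2)] that(3) by (metis disjoint_iff)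
  qed (rule finite_edges)
  then show ?thesis by (simp add: Union_edges_all)
qed

lemma twist_twist [simp]: "twist (twist M D) D = M"
proof -
  have "twist (twist M D) D = twist M D\<lparr>bcor := bcor M\<rparr>"
    by (simp add: twist_def[of "twist M D"] comp_def)
  then show ?thesis by (simp add: twist_def)
qed

lemma ribbon_graph_twist: "ribbon_graph (twist M D)"
proof
  let ?f = "swap M D \<circ> bcor M \<circ> swap M D"
  have b: "bcor M (bcor M x) = x" "x \<notin> S \<Longrightarrow> bcor M x = x" for x
    using inv_bcor by (cases "x \<in> S"; auto simp: fpf_involution_on_def permutes_def)+
  have inv: "?f (?f x) = x" for x
    by (simp add: b)
  moreover have "?f x = x" if "x \<notin> S" for x
    using that by (simp add: b swap_notin)
  ultimately have "?f permutes S"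
    unfolding permutes_def by metis
  moreover have "?f x \<noteq> x" if "x \<in> S" for x
  proof
    assume "?f x = x"
    then have "swap M D (?f x) = swap M D x" by (rule arg_cong)
    then show False
      using inv_bcor that by (simp add: fpf_involution_on_def)
  qed
  ultimately show "fpf_involution_on (sides (twist M D)) (bcor (twist M D))"
    using inv by (simp add: fpf_involution_on_def)
qed (use finite_sides inv_opp inv_wcor in simp_all)

lemma comp_rel_all: "num_components_without M {} = nc S"
  by (simp add: num_components_without_def comp_rel_def)

text \<open>Turns deletion into insertion: \<open>e\<close> lists the edges from the last to the
  first, so what is left after deleting the first \<open>n - j\<close> edges is an initial segment
  of \<open>e\<close>.\<close>

lemma edge_enumeration:
  assumes r: "linear_order_on (edges M) r" and n: "n = card (edges M)"
  obtains e where "bij_betw e {..<n} (edges M)"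
    "\<And>j. j \<le> n \<Longrightarrow> S - \<Union>(first_edges M r (n - j)) = \<Union>(e ` {..<j})"
proof
  let ?rk = "\<lambda>a. card {b \<in> edges M. (b, a) \<in> r}"
  \<comment> \<open>Ranks run from 1 to \<open>n\<close> and positions from 0 to
    \<open>n - 1\<close>, so \<open>e j\<close> is the edge of rank \<open>n - j\<close>.\<close>
  define e where "e = inv_into (edges M) ?rk \<circ> (\<lambda>j. n - j)"
  have rk: "bij_betw ?rk (edges M) {1..n}"
    unfolding n by (rule linear_order_rank[OF finite_edges r])
  have "bij_betw (\<lambda>j. n - j) {..<n} {1..n}"
    by (rule bij_betw_byWitness[where f' = "\<lambda>j. n - j"]) auto
  then show bij: "bij_betw e {..<n} (edges M)"
    unfolding e_def by (rule bij_betw_trans[OF _ bij_betw_inv_into[OF rk]])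
  have rk_e: "?rk (e j) = n - j" if "j < n" for j
    using bij_betw_inv_into_right[OF rk, of "n - j"] that by (simp add: e_def)
  fix j assume j: "j \<le> n"
  have "e ` {..<j} = edges M - first_edges M r (n - j)"
  proof (intro equalityI subsetI)
    fix a assume "a \<in> e ` {..<j}"
    then obtain i where i: "i < j" "a = e i" by auto
    then have "a \<in> edges M" using bij j by (auto simp: bij_betw_def)
    then show "a \<in> edges M - first_edges M r (n - j)"
      using rk_e[of i] i j by (simp add: first_edges_def)
  next
    fix a assume a: "a \<in> edges M - first_edges M r (n - j)"
    then obtain i where i: "i < n" "a = e i" using bij by (auto simp: bij_betw_def)
    then have "i < j" using a rk_e[of i] by (auto simp: first_edges_def)
    then show "a \<in> e ` {..<j}" using i by simp
  qed
  then have *: "\<Union>(e ` {..<j}) = \<Union>(edges M - first_edges M r (n - j))" by simp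
  have F: "first_edges M r (n - j) \<subseteq> edges M"
    by (auto simp: first_edges_def)
  show "S - \<Union>(first_edges M r (n - j)) = \<Union>(e ` {..<j})"
  proof (rule set_eqI)
    fix x
    show "x \<in> S - \<Union>(first_edges M r (n - j)) \<longleftrightarrow> x \<in> \<Union>(e ` {..<j})"
      unfolding * using Union_edges[OF F, of x]
        Union_edges[of "edges M - first_edges M r (n - j)" x] Union_edges[of "edges M" x]
      by (auto simp only: Union_edges_all Diff_iff Diff_subset)
  qed
qed

text \<open>Deleting \<open>i\<close> edges is stage \<open>n - i\<close> of the insertion. Stage
  \<open>n\<close> is the one-face condition because the map is connected, and stage 0 always holds;
  so \<open>good\<close> is the condition counted by \<open>greedy_count\<close>. The factor 2 on
  the left is \<open>2 ^ nc S\<close>.\<close>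

lemma good_twists:
  assumes r: "linear_order_on (edges M) r" and conn: "nc S = 1"
  shows "2 * card {D. D \<subseteq> edges M \<and> good (twist M D) r} =
    card {(L1, L2). L1 \<subseteq> S \<and> flipped S (opp M) L1 \<and> flipped S (wcor M) L1 \<and>
     L2 \<subseteq> S \<and> flipped S (opp M) L2 \<and> flipped S (bcor M) L2}"
proof -
  define n where "n = card (edges M)"
  obtain e where e: "bij_betw e {..<n} (edges M)"
    and X: "\<And>j. j \<le> n \<Longrightarrow> S - \<Union>(first_edges M r (n - j)) = \<Union>(e ` {..<j})"
    using edge_enumeration[OF r n_def] by metis
  have all: "\<Union>(e ` {..<n}) = S"
    using e by (simp add: bij_betw_def Union_edges_all)
  have F: "first_edges M r i \<subseteq> edges M" for i
    by (auto simp: first_edges_def)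
  have "good (twist M D) r \<longleftrightarrow> (\<forall>j\<le>n. nf D (\<Union>(e ` {..<j})) = nc (\<Union>(e ` {..<j})))" (is "_ \<longleftrightarrow> (\<forall>j\<le>n. ?ok j)") for D
  proof -
    have "num_faces (twist M D) = 1 \<longleftrightarrow> ?ok n"
      using num_faces_twist[of "{}" D] conn all by simp
    moreover have "num_components_without (twist M D) (first_edges M r i) = num_faces_without (twist M D) (first_edges M r i)
      \<longleftrightarrow> ?ok (n - i)" if "i < n" for i
      using X[of "n - i"] that num_faces_twist[OF F, of D] num_components_twist[OF F, of D] by auto
    ultimately have "good (twist M D) r \<longleftrightarrow> ?ok n \<and> (\<forall>i. 1 \<le> i \<and> i < n \<longrightarrow> ?ok (n - i))"
      by (simp add: good_def n_def[symmetric])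
    also have "\<dots> \<longleftrightarrow> (\<forall>j\<le>n. ?ok j)"
    proof
      assume *: "?ok n \<and> (\<forall>i. 1 \<le> i \<and> i < n \<longrightarrow> ?ok (n - i))"
      show "\<forall>j\<le>n. ?ok j"
      proof (intro allI impI)
        fix j assume "j \<le> n"
        then consider "j = 0" | "j = n" | "1 \<le> n - j" "n - j < n" "n - (n - j) = j" by linarith
        then show "?ok j"
        proof cases
          case 1
          then show ?thesis using num_classes_empty by simp
        next
          case 3
          then show ?thesis using * by metis
        qed (use * in simp)
      qed
    qed auto
    finally show ?thesis .
  qed
  then have "{D. D \<subseteq> edges M \<and> good (twist M D) r} =
    {D. D \<subseteq> e ` {..<n} \<and> (\<forall>j\<le>n. nf D (\<Union>(e ` {..<j})) = nc (\<Union>(e ` {..<j})))}"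
    using e by (simp add: bij_betw_def)
  then show ?thesis
    using greedy_count[OF e, of n] unfolding all conn card_disc_orientations
    by (simp only: order_refl simp_thms power_one_right mult.commute)
qed

end

section \<open>Orientations of the discs and orientations of the surface\<close>

lemma is_orientation_iff:
  "is_orientation M L \<longleftrightarrow> L \<subseteq> sides M \<and> flipped (sides M) (opp M) L \<and> flipped (sides M) (wcor M) L \<and>
     flipped (sides M) (bcor M) L"
  by (auto simp: is_orientation_def flipped_def)

text \<open>When \<open>opp\<close> flips both sets, agreement at a side implies agreement at the
  opposite side, so this is a property of the edge (\<open>disagreement_iff\<close>). These are the
  edges to be twisted.\<close>

definition disagreement :: "'a bmap \<Rightarrow> 'a set \<Rightarrow> 'a set \<Rightarrow> 'a set set" where
  "disagreement M L1 L2 = {{x, opp M x} | x. x \<in> sides M \<and> \<not> (x \<in> L1 \<longleftrightarrow> x \<in> L2)}"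

lemma disagreement_twist [simp]: "disagreement (twist M D) = disagreement M"
  by (simp add: disagreement_def fun_eq_iff)

context ribbon_graph
begin

lemma is_map_twist [simp]: "is_map (twist M D) \<longleftrightarrow> is_map M"
proof -
  have "num_components_without (twist M D) {} = num_components_without M {}"
    using num_components_twist[of "{}" D] by (simp add: comp_rel_all)
  then show ?thesis
    using ribbon_graph_twist[of D] ribbon_graph_axioms
    by (simp add: is_map_def ribbon_graph_def)
qed

lemma disagreement_iff:
  assumes "flipped S (opp M) L1" "flipped S (opp M) L2" "x \<in> S"
  shows "{x, opp M x} \<in> disagreement M L1 L2 \<longleftrightarrow> \<not> (x \<in> L1 \<longleftrightarrow> x \<in> L2)"
proof
  assume "{x, opp M x} \<in> disagreement M L1 L2"
  then obtain y where y: "y \<in> S" "{x, opp M x} = {y, opp M y}" "\<not> (y \<in> L1 \<longleftrightarrow> y \<in> L2)"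
    by (auto simp: disagreement_def)
  then have "x = y \<or> x = opp M y" by (auto simp: doubleton_eq_iff)
  then show "\<not> (x \<in> L1 \<longleftrightarrow> x \<in> L2)"
    using y assms by (auto simp: flipped_def)
qed (use assms(3) in \<open>auto simp: disagreement_def\<close>)

lemma mem_iff_swap:
  assumes "flipped S (opp M) L1" "flipped S (opp M) L2" "x \<in> S"
  shows "swap M (disagreement M L1 L2) x \<in> L1 \<longleftrightarrow> x \<in> L2"
  using disagreement_iff[OF assms] assms by (auto simp: swap_def flipped_def)

lemma swap_image_iff: "x \<in> swap M D ` L \<longleftrightarrow> swap M D x \<in> L"
  by (metis image_iff swap_swap)

text \<open>With \<open>L1\<close> fixed, \<open>L2\<close> and the set of edges to be twisted
  determine each other; \<open>disagreement_swap\<close> is the other direction.\<close>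

lemma swap_disagreement_image:
  assumes "L1 \<subseteq> S" "L2 \<subseteq> S" "flipped S (opp M) L1" "flipped S (opp M) L2"
  shows "swap M (disagreement M L1 L2) ` L1 = L2"
proof (rule set_eqI)
  fix x
  show "x \<in> swap M (disagreement M L1 L2) ` L1 \<longleftrightarrow> x \<in> L2"
    unfolding swap_image_iff
    using mem_iff_swap[OF assms(3,4), of x] swap_notin[of x] assms(1,2) by (cases "x \<in> S") auto
qed

lemma disagreement_swap:
  assumes "flipped S (opp M) L" "D \<subseteq> edges M"
  shows "disagreement M L (swap M D ` L) = D"
proof -
  have *: "\<not> (x \<in> L \<longleftrightarrow> x \<in> swap M D ` L) \<longleftrightarrow> {x, opp M x} \<in> D" if "x \<in> S" for x
  proof (cases "{x, opp M x} \<in> D")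
    case True
    then have "swap M D x = opp M x" by (simp add: swap_def)
    then show ?thesis
      using True that assms(1) by (simp add: swap_image_iff flipped_def)
  next
    case False
    then have "swap M D x = x" by (simp add: swap_def)
    then show ?thesis
      using False by (simp add: swap_image_iff)
  qed
  have "disagreement M L (swap M D ` L) = {{x, opp M x} | x. x \<in> S \<and> {x, opp M x} \<in> D}"
    unfolding disagreement_def by (rule Collect_cong) (use * in metis)
  also have "\<dots> = D"
    using assms(2) unfolding edges_def by blast
  finally show ?thesis .
qed

text \<open>In the twisted map the black corners are read through \<open>swap\<close>, which
  exchanges \<open>L1\<close> and \<open>L2\<close>; hence flipping \<open>L2\<close> along
  \<open>bcor M\<close> becomes flipping \<open>L1\<close> along the new black corners.\<close>

lemma orientation_twist:
  assumes "L1 \<subseteq> S" "flipped S (opp M) L1" "flipped S (wcor M) L1"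
    and "flipped S (opp M) L2" "flipped S (bcor M) L2"
  shows "is_orientation (twist M (disagreement M L1 L2)) L1"
proof -
  have "swap M (disagreement M L1 L2) (bcor M (swap M (disagreement M L1 L2) x)) \<in> L1 \<longleftrightarrow> x \<notin> L1"
    if "x \<in> S" for x
    using mem_iff_swap[OF assms(2,4)] assms(5) bcor_in that
    by (metis flipped_def swap_in swap_swap)
  then show ?thesis
    using assms(1-3) by (simp add: is_orientation_iff flipped_def)
qed

lemma orientation_untwist:
  assumes "is_orientation M L"
  shows "swap M D ` L \<subseteq> S \<and> flipped S (opp M) (swap M D ` L) \<and>
    flipped S (bcor (twist M D)) (swap M D ` L)"
proof -
  have L: "L \<subseteq> S" "\<And>x. x \<in> S \<Longrightarrow> opp M x \<in> L \<longleftrightarrow> x \<notin> L" "\<And>x. x \<in> S \<Longrightarrow> bcor M x \<in> L \<longleftrightarrow> x \<notin> L"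
    using assms by (auto simp: is_orientation_def)
  then show ?thesis
    by (auto simp: flipped_def swap_image_iff opp_swap[symmetric])
qed

end

section \<open>Double counting over all labelled maps with an edge order\<close>

definition maps :: "nat \<Rightarrow> (nat bmap \<times> (nat set \<times> nat set) set) set" where
  "maps n = {(M, r). is_map M \<and> sides M = {..<2 * n} \<and> linear_order_on (edges M) r}"

text \<open>The fields are functions on all natural numbers, but as permutations of the sides they
  are the identity elsewhere, which leaves finitely many.\<close>

lemma finite_maps: "finite (maps n)"
proof -
  let ?S = "{..<2 * n}"
  let ?F = "{f. f permutes ?S}"
  have "finite ?F" by (intro finite_permutations) simp
  then have "finite (?F \<times> ?F \<times> ?F \<times> Pow (Pow ?S \<times> Pow ?S))" by simp
  moreover have "maps n \<subseteq> (\<lambda>(f, g, h, r). (\<lparr>sides = ?S, opp = f, wcor = g, bcor = h\<rparr>, r)) `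
    (?F \<times> ?F \<times> ?F \<times> Pow (Pow ?S \<times> Pow ?S))"
  proof
    fix p assume "p \<in> maps n"
    then obtain M r where p: "p = (M, r)" "is_map M" "sides M = ?S" "linear_order_on (edges M) r"
      by (auto simp: maps_def)
    interpret ribbon_graph M using p(2) by (simp add: is_map_iff)
    have "edges M \<subseteq> Pow ?S"
      using Union_edges_all p(3) by blast
    then have "r \<subseteq> Pow ?S \<times> Pow ?S"
      using p(4) by (auto simp: order_on_defs)
    moreover have "p = (\<lparr>sides = ?S, opp = opp M, wcor = wcor M, bcor = bcor M\<rparr>, r)"
      using p by simp
    ultimately show "p \<in> (\<lambda>(f, g, h, r). (\<lparr>sides = ?S, opp = f, wcor = g, bcor = h\<rparr>, r)) `
      (?F \<times> ?F \<times> ?F \<times> Pow (Pow ?S \<times> Pow ?S))"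
      using inv_opp inv_wcor inv_bcor p(3)
      by (intro image_eqI[where x = "(opp M, wcor M, bcor M, r)"]) (auto simp: fpf_involution_on_def)
  qed
  ultimately show ?thesis by (rule finite_surj)
qed

lemma mapsD:
  assumes "p \<in> maps n"
  shows "ribbon_graph (fst p)" "sides (fst p) = {..<2 * n}" "card (edges (fst p)) = n"
    "linear_order_on (edges (fst p)) (snd p)" "num_classes (points (fst p)) (comp_rel (fst p) (sides (fst p))) = 1"
    "finite (edges (fst p))"
proof -
  show rg: "ribbon_graph (fst p)" "sides (fst p) = {..<2 * n}" "linear_order_on (edges (fst p)) (snd p)"
    "num_classes (points (fst p)) (comp_rel (fst p) (sides (fst p))) = 1"
    using assms unfolding maps_def is_map_iff mem_Collect_eq case_prod_beta by blast+
  interpret ribbon_graph "fst p" by fact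
  show "card (edges (fst p)) = n" "finite (edges (fst p))"
    using card_edges rg(2) finite_edges by simp_all
qed

lemma twist_maps:
  assumes "(M, r) \<in> maps n"
  shows "(twist M D, r) \<in> maps n" "twist (twist M D) D = M"
proof -
  interpret ribbon_graph M using mapsD(1)[OF assms] by simp
  show "(twist M D, r) \<in> maps n" "twist (twist M D) D = M"
    using assms by (simp_all add: maps_def)
qed

text \<open>
  An orientation of all white discs and one of all black discs together amount to an oriented
  map plus the set of edges that have to be twisted for the two to agree.
\<close>

lemma card_good_orientations:
  "2 * card {p \<in> maps n. good (fst p) (snd p)} = card (SIGMA p : maps n. {L. is_orientation (fst p) L})"
proof -
  let ?tw = "\<lambda>p D. (twist (fst p) D, snd p)"
  let ?G = "{p \<in> maps n. good (fst p) (snd p)}"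
  let ?O = "SIGMA p : maps n. {L. is_orientation (fst p) L}"
  let ?GD = "SIGMA p : maps n. {D. D \<subseteq> edges (fst p) \<and> good (twist (fst p) D) (snd p)}"
  let ?LL = "\<lambda>M. {(L1, L2). L1 \<subseteq> sides M \<and> flipped (sides M) (opp M) L1 \<and> flipped (sides M) (wcor M) L1 \<and>
     L2 \<subseteq> sides M \<and> flipped (sides M) (opp M) L2 \<and> flipped (sides M) (bcor M) L2}"
  let ?OO = "SIGMA p : maps n. ?LL (fst p)"
  have finG: "finite ?G" using finite_maps by simp
  have fin_or: "finite {L. is_orientation (fst p) L}" if "p \<in> maps n" for p
    by (rule finite_subset[of _ "Pow (sides (fst p))"])
      (use mapsD(2)[OF that] in \<open>auto simp: is_orientation_def\<close>)
  have finO: "finite ?O" using finite_maps fin_or by blast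
  have finD: "finite {D. D \<subseteq> edges (fst p) \<and> good (twist (fst p) D) (snd p)}" if "p \<in> maps n" for p
    using mapsD(6)[OF that] by simp
  have finL: "finite (?LL (fst p))" if "p \<in> maps n" for p
    by (rule finite_subset[of _ "Pow (sides (fst p)) \<times> Pow (sides (fst p))"])
      (use mapsD(2)[OF that] in auto)
  have pow: "card (Pow (edges (fst p))) = 2 ^ n" if "p \<in> maps n" for p
    using mapsD(3,6)[OF that] by (simp add: card_Pow)
  \<comment> \<open>Twisting is an involution: instead of a map whose twist by \<open>D\<close> is
    good, take a good map and an arbitrary \<open>D\<close>. Each good map is thus counted
    \<open>2 ^ n\<close> times.\<close>
  have "bij_betw (\<lambda>(p, D). (?tw p D, D)) ?GD (SIGMA p : ?G. Pow (edges (fst p)))"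
    by (rule bij_betw_byWitness[where f' = "\<lambda>(p, D). (?tw p D, D)"])
      (auto simp: twist_maps)
  then have "card ?GD = card (SIGMA p : ?G. Pow (edges (fst p)))"
    by (rule bij_betw_same_card)
  also have "\<dots> = (\<Sum>p\<in>?G. card (Pow (edges (fst p))))"
    using finG mapsD(6)[of _ n] by (intro card_SigmaI) auto
  also have "\<dots> = (\<Sum>p\<in>?G. 2 ^ n)"
    by (intro sum.cong refl pow) simp
  finally have 1: "card ?GD = card ?G * 2 ^ n" by simp
  \<comment> \<open>Recording the twisted set makes the passage to an oriented map reversible:
    untwist, keep \<open>L\<close> on the white discs and use its image under \<open>swap\<close> on
    the black ones. Conversely any \<open>D\<close> is possible, which gives the same factor
    \<open>2 ^ n\<close>.\<close>
  have "bij_betw (\<lambda>(p, L1, L2). ((?tw p (disagreement (fst p) L1 L2), L1), disagreement (fst p) L1 L2))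
    ?OO (SIGMA q : ?O. Pow (edges (fst (fst q))))" (is "bij_betw ?f _ _")
  proof (rule bij_betw_byWitness[where f' = "\<lambda>((p, L), D). (?tw p D, L, swap (fst p) D ` L)"])
    let ?f' = "\<lambda>((p, L), D). (?tw p D, L, swap (fst p) D ` L)"
    show "\<forall>a\<in>?OO. ?f' (?f a) = a"
    proof
      fix a assume "a \<in> ?OO"
      then obtain M r L1 L2 where a: "a = ((M, r), L1, L2)" "(M, r) \<in> maps n" "(L1, L2) \<in> ?LL M"
        by (cases a) auto
      interpret ribbon_graph M using mapsD(1)[OF a(2)] by simp
      show "?f' (?f a) = a"
        using a(3) by (simp add: a(1) swap_disagreement_image)
    qed
    show "\<forall>b\<in>SIGMA q : ?O. Pow (edges (fst (fst q))). ?f (?f' b) = b"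
    proof
      fix b assume "b \<in> (SIGMA q : ?O. Pow (edges (fst (fst q))))"
      then obtain M r L D where b: "b = (((M, r), L), D)" "(M, r) \<in> maps n" "is_orientation M L" "D \<subseteq> edges M"
        by (cases b) auto
      interpret ribbon_graph M using mapsD(1)[OF b(2)] by simp
      show "?f (?f' b) = b"
        using b(3,4) by (simp add: b(1) disagreement_swap is_orientation_iff)
    qed
    show "?f ` ?OO \<subseteq> (SIGMA q : ?O. Pow (edges (fst (fst q))))"
    proof (rule image_subsetI)
      fix a assume "a \<in> ?OO"
      then obtain M r L1 L2 where a: "a = ((M, r), L1, L2)" "(M, r) \<in> maps n" "(L1, L2) \<in> ?LL M"
        by (cases a) auto
      interpret ribbon_graph M using mapsD(1)[OF a(2)] by simp
      have "disagreement M L1 L2 \<subseteq> edges M"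
        by (auto simp: disagreement_def edges_def)
      then show "?f a \<in> (SIGMA q : ?O. Pow (edges (fst (fst q))))"
        using a(3) orientation_twist[of L1 L2] twist_maps(1)[OF a(2)] by (simp add: a(1))
    qed
    show "?f' ` (SIGMA q : ?O. Pow (edges (fst (fst q)))) \<subseteq> ?OO"
    proof (rule image_subsetI)
      fix b assume "b \<in> (SIGMA q : ?O. Pow (edges (fst (fst q))))"
      then obtain M r L D where b: "b = (((M, r), L), D)" "(M, r) \<in> maps n" "is_orientation M L" "D \<subseteq> edges M"
        by (cases b) auto
      interpret ribbon_graph M using mapsD(1)[OF b(2)] by simp
      show "?f' b \<in> ?OO"
        using b(3) orientation_untwist[OF b(3), of D] twist_maps(1)[OF b(2), of D]
        by (simp add: b(1) is_orientation_iff)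
    qed
  qed
  then have "card ?OO = card (SIGMA q : ?O. Pow (edges (fst (fst q))))"
    by (rule bij_betw_same_card)
  also have "\<dots> = (\<Sum>q\<in>?O. card (Pow (edges (fst (fst q)))))"
    using finO mapsD(6)[of _ n] by (intro card_SigmaI) auto
  also have "\<dots> = (\<Sum>q\<in>?O. 2 ^ n)"
    by (intro sum.cong refl pow) auto
  finally have 2: "card ?OO = card ?O * 2 ^ n" by simp
  have "2 * card ?GD = (\<Sum>p\<in>maps n. 2 * card {D. D \<subseteq> edges (fst p) \<and> good (twist (fst p) D) (snd p)})"
    using finite_maps finD by (simp add: card_SigmaI sum_distrib_left)
  also have "\<dots> = (\<Sum>p\<in>maps n. card (?LL (fst p)))"
    by (intro sum.cong refl ribbon_graph.good_twists mapsD)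
  also have "\<dots> = card ?OO"
    using finite_maps finL by (subst card_SigmaI) auto
  finally show ?thesis
    unfolding 1 2 by simp
qed

lemma card_nonoriented_oriented: "card (nonoriented_labelled n) = card (oriented_labelled n)"
proof -
  let ?G = "{p \<in> maps n. good (fst p) (snd p)}"
  let ?O = "SIGMA p : maps n. {L. is_orientation (fst p) L}"
  have fin_or: "finite {L. is_orientation (fst p) L}" if "p \<in> maps n" for p
    by (rule finite_subset[of _ "Pow (sides (fst p))"])
      (use mapsD(2)[OF that] in \<open>auto simp: is_orientation_def\<close>)
  have finO: "finite ?O" using finite_maps fin_or by blast
  have good_iff: "good M r \<longleftrightarrow> num_faces M = 1 \<and> (\<forall>i. 1 \<le> i \<and> i < n \<longrightarrow>
     num_components_without M (first_edges M r i) = num_faces_without M (first_edges M r i))"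
    if "(M, r) \<in> maps n" for M r
    using mapsD(3)[OF that] by (simp add: good_def)
  have NL: "(M, root, r) \<in> nonoriented_labelled n \<longleftrightarrow> (M, r) \<in> maps n \<and> good M r \<and> root < 2 * n" for M root r
  proof (cases "(M, r) \<in> maps n")
    case True
    then show ?thesis
      unfolding good_iff[OF True] by (auto simp: nonoriented_labelled_def maps_def)
  qed (auto simp: nonoriented_labelled_def maps_def)
  have OL: "(M, L, root, r) \<in> oriented_labelled n \<longleftrightarrow> (M, r) \<in> maps n \<and> is_orientation M L \<and> root \<in> edges M"
    for M L root r
    unfolding oriented_labelled_def maps_def mem_Collect_eq prod.case by blast
  have "bij_betw (\<lambda>(M, root, r). ((M, r), root)) (nonoriented_labelled n) (?G \<times> {..<2 * n})"
    by (rule bij_betw_byWitness[where f' = "\<lambda>((M, r), root). (M, root, r)"])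
      (auto simp: NL)
  then have "card (nonoriented_labelled n) = card (?G \<times> {..<2 * n})"
    by (rule bij_betw_same_card)
  also have "\<dots> = 2 * card ?G * n"
    by (simp add: card_cartesian_product)
  also have "\<dots> = (\<Sum>q\<in>?O. n)"
    unfolding card_good_orientations by simp
  also have "\<dots> = (\<Sum>q\<in>?O. card (edges (fst (fst q))))"
    by (intro sum.cong refl) (auto dest: mapsD(3))
  also have "\<dots> = card (SIGMA q : ?O. edges (fst (fst q)))"
    using finO mapsD(6)[of _ n] by (subst card_SigmaI) auto
  also have "\<dots> = card (oriented_labelled n)"
  proof (rule bij_betw_same_card[symmetric])
    show "bij_betw (\<lambda>(M, L, root, r). (((M, r), L), root)) (oriented_labelled n)
      (SIGMA q : ?O. edges (fst (fst q)))"
      by (rule bij_betw_byWitness[where f' = "\<lambda>(((M, r), L), root). (M, L, root, r)"])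
        (auto simp: OL)
  qed
  finally show ?thesis .
qed

section \<open>Relabelling the edge sides\<close>

text \<open>Orbit counting: since only \<open>id\<close> fixes a point, each orbit is in bijection
  with the permutations of \<open>S\<close>.\<close>

lemma card_free_action:
  assumes fin: "finite X" "finite S"
    and id: "\<And>p. p \<in> X \<Longrightarrow> act id p = p"
    and comp: "\<And>p f g. p \<in> X \<Longrightarrow> f permutes S \<Longrightarrow> g permutes S \<Longrightarrow> act (f \<circ> g) p = act f (act g p)"
    and closed: "\<And>p f. p \<in> X \<Longrightarrow> f permutes S \<Longrightarrow> act f p \<in> X"
    and free: "\<And>p f. p \<in> X \<Longrightarrow> f permutes S \<Longrightarrow> act f p = p \<Longrightarrow> f = id"
  shows "fact (card S) * card (X // {(p, q). p \<in> X \<and> q \<in> X \<and> (\<exists>f. f permutes S \<and> q = act f p)}) = card X"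
proof -
  define R where "R = {(p, q). p \<in> X \<and> q \<in> X \<and> (\<exists>f. f permutes S \<and> q = act f p)}"
  have inv_act: "act (inv f) (act f p) = p" if "p \<in> X" "f permutes S" for p f
    using comp[OF that(1) permutes_inv[OF that(2)] that(2)] id[OF that(1)] permutes_inv_o(2)[OF that(2)] by simp
  have eq: "equiv X R"
  proof (rule equivI)
    show "R \<subseteq> X \<times> X" by (auto simp: R_def)
    show "refl_on X R"
    proof (rule refl_onI)
      show "(p, p) \<in> R" if "p \<in> X" for p
        using that id[OF that] permutes_id[of S] unfolding R_def by fastforce
    qed
    show "sym R"
    proof (rule symI)
      fix p q assume "(p, q) \<in> R"
      then obtain f where f: "p \<in> X" "q \<in> X" "f permutes S" "q = act f p" by (auto simp: R_def)
      then have "p = act (inv f) q" using inv_act by simp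
      then show "(q, p) \<in> R" using f permutes_inv[of f S] by (auto simp: R_def)
    qed
    show "trans R"
    proof (rule transI)
      fix p q s assume "(p, q) \<in> R" "(q, s) \<in> R"
      then obtain f g where f: "p \<in> X" "s \<in> X" "f permutes S" "g permutes S" "s = act g (act f p)"
        by (auto simp: R_def)
      then have "s = act (g \<circ> f) p" using comp by simp
      then show "(p, s) \<in> R"
        using f permutes_compose[of f S g] by (auto simp: R_def)
    qed
  qed
  have "fact (card S) * card (X // R) = card (\<Union>(X // R))"
  proof (rule card_partition)
    show "finite (X // R)" using fin eq by (simp add: finite_quotient equiv_def)
    show "finite (\<Union>(X // R))" using fin eq by (simp add: Union_quotient)
    show "c \<inter> d = {}" if "c \<in> X // R" "d \<in> X // R" "c \<noteq> d" for c d
      using quotient_disj[OF eq that(1,2)] that(3) by blast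
    show "card c = fact (card S)" if c: "c \<in> X // R" for c
    proof -
      obtain p where p: "p \<in> X" "c = R `` {p}" using c by (rule quotientE)
      have "c = (\<lambda>f. act f p) ` {f. f permutes S}"
        using p closed by (auto simp: R_def)
      moreover have "inj_on (\<lambda>f. act f p) {f. f permutes S}"
      proof (rule inj_onI, clarify)
        fix f g assume fg: "f permutes S" "g permutes S" "act f p = act g p"
        have "act (inv g \<circ> f) p = act (inv g) (act g p)"
          using comp[OF p(1) permutes_inv[OF fg(2)] fg(1)] fg(3) by simp
        then have "inv g \<circ> f = id"
          using free[OF p(1) permutes_compose[OF fg(1) permutes_inv[OF fg(2)]]] inv_act[OF p(1) fg(2)] by simp
        then have "g \<circ> (inv g \<circ> f) = g" by simp
        then show "f = g"
          using permutes_inv_o(1)[OF fg(2)] by (simp add: o_assoc)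
      qed
      ultimately show ?thesis
        using card_permutations[OF refl fin(2)] by (simp add: card_image)
    qed
  qed
  then show ?thesis
    using eq by (simp add: Union_quotient R_def)
qed

section \<open>Transport of maps, orders and orientations along a relabelling\<close>

definition move :: "('a \<Rightarrow> 'a) \<Rightarrow> 'a bmap \<Rightarrow> 'a bmap" where
  "move f M = \<lparr>sides = f ` sides M, opp = f \<circ> opp M \<circ> inv f, wcor = f \<circ> wcor M \<circ> inv f,
     bcor = f \<circ> bcor M \<circ> inv f\<rparr>"

definition move_order :: "('a \<Rightarrow> 'a) \<Rightarrow> ('a set \<times> 'a set) set \<Rightarrow> ('a set \<times> 'a set) set" where
  "move_order f r = map_prod ((`) f) ((`) f) ` r"

lemma move_simps [simp]:
  "sides (move f M) = f ` sides M" "opp (move f M) = f \<circ> opp M \<circ> inv f"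
  "wcor (move f M) = f \<circ> wcor M \<circ> inv f" "bcor (move f M) = f \<circ> bcor M \<circ> inv f"
  by (simp_all add: move_def)

lemma move_id: "move id M = M"
  by (simp add: move_def)

lemma move_comp:
  assumes "bij f" "bij g"
  shows "move (f \<circ> g) M = move f (move g M)"
  using assms by (simp add: move_def o_inv_distrib image_comp comp_assoc)

lemma move_order_id: "move_order id r = r"
  by (simp add: move_order_def image_id prod.map_id0)

lemma move_order_comp: "move_order (f \<circ> g) r = move_order f (move_order g r)"
  by (force simp: move_order_def image_comp)

lemma move_order_iff:
  assumes "bij f"
  shows "(f ` a, f ` b) \<in> move_order f r \<longleftrightarrow> (a, b) \<in> r"
  using bij_is_inj[OF assms] by (auto simp: move_order_def inj_image_eq_iff)

lemma edges_move:
  assumes "bij f"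
  shows "edges (move f M) = (`) f ` edges M"
proof -
  have "edges N = (\<lambda>x. {x, opp N x}) ` sides N" for N :: "'a bmap"
    by (auto simp: edges_def)
  then show ?thesis
    using bij_is_inj[OF assms] by (simp add: image_image inv_f_f)
qed

lemma fpf_involution_move:
  assumes "bij f" "fpf_involution_on S g"
  shows "fpf_involution_on (f ` S) (f \<circ> g \<circ> inv f)"
proof -
  have inj: "inj f" using assms(1) by (rule bij_is_inj)
  have S: "x \<in> f ` S \<longleftrightarrow> inv f x \<in> S" for x
    using assms(1) by (metis bij_inv_eq_iff image_iff)
  have g: "g x \<in> S" "g (g x) = x" "g x \<noteq> x" if "x \<in> S" for x
    using assms(2) that by (auto simp: fpf_involution_on_def permutes_in_image)
  have out: "g x = x" if "x \<notin> S" for x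
    using assms(2) that by (auto simp: fpf_involution_on_def permutes_def)
  let ?h = "f \<circ> g \<circ> inv f"
  have gg: "g (g x) = x" for x using g out by (cases "x \<in> S") auto
  have hh: "?h (?h x) = x" for x
    using inj assms(1) gg by (simp add: bij_inv_eq_iff inv_f_f bij_is_surj surj_f_inv_f)
  moreover have "?h x = x" if "x \<notin> f ` S" for x
    using that out assms(1) by (simp add: S bij_is_surj surj_f_inv_f)
  ultimately have "?h permutes f ` S"
    unfolding permutes_def by metis
  moreover have "?h x \<noteq> x" if "x \<in> f ` S" for x
    using that g inj by (auto simp: inv_f_f inj_eq)
  ultimately show ?thesis
    using hh by (simp add: fpf_involution_on_def)
qed

context ribbon_graph
begin

lemma rel_move:
  assumes f: "bij f"
  shows "corner_arcs (move f M) = map_prod (map_prod f id) (map_prod f id) ` corner_arcs M"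
    and "ribbon_sides (f ` X) = map_prod (map_prod f id) (map_prod f id) ` ribbon_sides X"
    and "attaching_arcs (move f M) (f ` X) = map_prod (map_prod f id) (map_prod f id) ` attaching_arcs M X"
    and "points (move f M) = map_prod f id ` points M"
  using bij_is_inj[OF f]
  by (force simp: corner_arcs_def ribbon_sides_def attaching_arcs_def points_def inv_f_f image_iff)+

lemma num_without_move:
  assumes f: "bij f" and F: "F \<subseteq> edges M"
  shows "num_faces_without (move f M) ((`) f ` F) = num_faces_without M F"
    and "num_components_without (move f M) ((`) f ` F) = num_components_without M F"
proof -
  let ?h = "map_prod f (id :: colour \<Rightarrow> colour)"
  have inj: "inj_on ?h P"
    using bij_is_inj[OF f] by (auto simp: inj_on_def)
  have U: "\<Union>((`) f ` F) = f ` \<Union>F" by auto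
  have diff: "f ` S - f ` \<Union>F = f ` (S - \<Union>F)"
    using bij_is_inj[OF f] by (simp add: image_set_diff)
  have sub: "corner_arcs M \<union> ribbon_sides (S - \<Union>F) \<union> attaching_arcs M X \<subseteq> P \<times> P" if "X \<subseteq> S" for X
    using that by (auto simp: corner_arcs_def ribbon_sides_def attaching_arcs_def points_def wcor_in bcor_in)
  show "num_faces_without (move f M) ((`) f ` F) = num_faces_without M F"
    "num_components_without (move f M) ((`) f ` F) = num_components_without M F"
    unfolding num_faces_without_def num_components_without_def U move_simps(1) diff rel_move[OF f]
      image_Un[symmetric]
    by (rule num_classes_image[OF inj sub], use Union_edges_subset[OF F] in blast)+
qed

lemma is_map_move:
  assumes "bij f" "is_map M"
  shows "is_map (move f M)"
  using assms num_without_move(2)[OF assms(1), of "{}"] fpf_involution_move[OF assms(1)]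
  by (simp add: is_map_def)

lemma first_edges_move:
  assumes f: "bij f"
  shows "first_edges (move f M) (move_order f r) i = (`) f ` first_edges M r i"
proof -
  have "{b \<in> (`) f ` edges M. (b, f ` a) \<in> move_order f r} = (`) f ` {b \<in> edges M. (b, a) \<in> r}" for a
    using move_order_iff[OF f] by auto
  moreover have "card ((`) f ` A) = card A" for A :: "'a set set"
    using bij_is_inj[OF f] by (intro card_image) (auto simp: inj_on_def inj_image_eq_iff)
  ultimately show ?thesis
    by (auto simp: first_edges_def edges_move[OF f])
qed

lemma linear_order_move:
  assumes f: "bij f" and r: "linear_order_on (edges M) r"
  shows "linear_order_on (edges (move f M)) (move_order f r)"
proof -
  have ex: "\<exists>a b. x = f ` a \<and> y = f ` b \<and> (a, b) \<in> r" if "(x, y) \<in> move_order f r" for x y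
    using that by (auto simp: move_order_def)
  note iff = move_order_iff[OF f]
  have inj: "f ` a = f ` b \<longleftrightarrow> a = b" for a b
    using bij_is_inj[OF f] by (rule inj_image_eq_iff)
  have r': "r \<subseteq> edges M \<times> edges M" "\<And>a. a \<in> edges M \<Longrightarrow> (a, a) \<in> r" "trans r" "antisym r" "total_on (edges M) r"
    using r by (auto simp: order_on_defs refl_on_def)
  have "move_order f r \<subseteq> edges (move f M) \<times> edges (move f M)"
    using r'(1) by (auto simp: edges_move[OF f] move_order_def)
  moreover have "refl_on (edges (move f M)) (move_order f r)"
    using r'(2) by (auto simp: refl_on_def edges_move[OF f] iff)
  moreover have "trans (move_order f r)"
  proof (rule transI)
    fix x y z assume xy: "(x, y) \<in> move_order f r" and yz: "(y, z) \<in> move_order f r"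
    obtain a b where ab: "x = f ` a" "y = f ` b" "(a, b) \<in> r" using ex[OF xy] by blast
    obtain b' c where bc: "y = f ` b'" "z = f ` c" "(b', c) \<in> r" using ex[OF yz] by blast
    have "b' = b" using ab(2) bc(1) inj by simp
    then have "(a, c) \<in> r" using transD[OF r'(3) ab(3)] bc(3) by simp
    then show "(x, z) \<in> move_order f r"
      using ab(1) bc(2) iff by simp
  qed
  moreover have "antisym (move_order f r)"
  proof (rule antisymI)
    fix x y assume xy: "(x, y) \<in> move_order f r" and yx: "(y, x) \<in> move_order f r"
    obtain a b where ab: "x = f ` a" "y = f ` b" "(a, b) \<in> r" using ex[OF xy] by blast
    obtain b' a' where ba: "y = f ` b'" "x = f ` a'" "(b', a') \<in> r" using ex[OF yx] by blast
    have "b' = b" "a' = a" using ab ba inj by simp_all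
    then show "x = y"
      using antisymD[OF r'(4) ab(3)] ba(3) ab by simp
  qed
  moreover have "total_on (edges (move f M)) (move_order f r)"
    using r'(5) by (auto simp: total_on_def edges_move[OF f] iff inj)
  ultimately show ?thesis by (simp add: order_on_defs)
qed

lemma orientation_move:
  assumes f: "bij f" and L: "is_orientation M L"
  shows "is_orientation (move f M) (f ` L)"
  using L bij_is_inj[OF f] by (auto simp: is_orientation_def inv_f_f inj_image_mem_iff)

lemma map_iso_move:
  assumes f: "bij f"
  shows "map_iso M (move f M) f"
  using bij_is_inj[OF f] by (auto simp: map_iso_def inv_f_f bij_betw_def inj_on_def)

lemma order_iso_move:
  assumes f: "bij f"
  shows "order_iso M r (move_order f r) f"
  by (simp add: order_iso_def move_order_iff[OF f])

text \<open>An isomorphism is constrained on the sides only, so it is extended by the identity to a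
  permutation. The conclusions are true equalities because all the involutions are the identity off
  the sides and the orders contain pairs of edges only.\<close>

lemma map_iso_imp_move:
  assumes M': "ribbon_graph M'" "sides M' = S" and iso: "map_iso M M' f" "order_iso M r r' f"
    and r: "linear_order_on (edges M) r" "linear_order_on (edges M') r'"
  obtains g where "g permutes S" "\<And>x. x \<in> S \<Longrightarrow> g x = f x" "M' = move g M" "r' = move_order g r"
proof
  define g where "g x = (if x \<in> S then f x else x)" for x
  interpret M': ribbon_graph M' by fact
  show gf: "g x = f x" if "x \<in> S" for x
    using that by (simp add: g_def)
  have "bij_betw f S S"
    using iso(1) M'(2) by (simp add: map_iso_def)
  then have "bij_betw g S S"
    using gf by (simp cong: bij_betw_cong)
  then show g: "g permutes S"
    by (rule bij_imp_permutes) (simp add: g_def)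
  then have bij: "bij g" by (rule permutes_bij)
  have gS: "g ` S = S" using g by (rule permutes_image)
  have fld: "F' = g \<circ> F \<circ> inv g"
    if F: "fpf_involution_on S F" "fpf_involution_on S F'" "\<And>x. x \<in> S \<Longrightarrow> f (F x) = F' (f x)" for F F'
  proof
    fix y
    show "F' y = (g \<circ> F \<circ> inv g) y"
    proof (cases "y \<in> S")
      case True
      then obtain x where x: "x \<in> S" "y = g x" using gS by blast
      moreover have "F x \<in> S" using F(1) x by (simp add: fpf_involution_on_def permutes_in_image)
      moreover have "inv g y = x"
        using x(2) bij_is_inj[OF bij] by (simp add: inv_f_f)
      ultimately show ?thesis
        using F(3)[OF x(1)] gf by simp
    next
      case False
      then have "F y = y" "F' y = y" "inv g y = y" "g y = y"
        using F g permutes_inv[OF g] by (auto simp: fpf_involution_on_def permutes_def)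
      then show ?thesis by simp
    qed
  qed
  show Mv: "M' = move g M"
  proof (rule bmap.equality)
    show "sides M' = sides (move g M)" using gS M'(2) by simp
    show "opp M' = opp (move g M)" "wcor M' = wcor (move g M)" "bcor M' = bcor (move g M)"
      unfolding move_simps using iso(1) M'.inv_opp M'.inv_wcor M'.inv_bcor M'(2) inv_opp inv_wcor inv_bcor
      by (auto intro!: fld simp: map_iso_def)
  qed simp
  have img: "f ` a = g ` a" if "a \<in> edges M" for a
  proof (intro image_cong refl)
    fix x assume "x \<in> a"
    then have "x \<in> S" using that Union_edges_all by blast
    then show "f x = g x" by (simp add: gf)
  qed
  have sub: "r \<subseteq> edges M \<times> edges M" "r' \<subseteq> edges M' \<times> edges M'"
    using r by (auto simp: order_on_defs)
  have E': "edges M' = (`) g ` edges M"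
    unfolding Mv by (rule edges_move[OF bij])
  have iff: "(a, b) \<in> r \<longleftrightarrow> (g ` a, g ` b) \<in> r'" if "a \<in> edges M" "b \<in> edges M" for a b
    using iso(2) that img by (auto simp: order_iso_def)
  show "r' = move_order g r"
  proof (intro equalityI subrelI)
    fix u v assume uv: "(u, v) \<in> r'"
    have "u \<in> (`) g ` edges M" "v \<in> (`) g ` edges M"
      using subsetD[OF sub(2) uv] unfolding E' by simp_all
    then obtain a b where "a \<in> edges M" "b \<in> edges M" "u = g ` a" "v = g ` b"
      by blast
    then show "(u, v) \<in> move_order g r"
      using uv iff move_order_iff[OF bij] by simp
  next
    fix u v assume "(u, v) \<in> move_order g r"
    then obtain a b where "(a, b) \<in> r" "u = g ` a" "v = g ` b"
      by (auto simp: move_order_def)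
    then show "(u, v) \<in> r'"
      using sub(1) iff by blast
  qed
qed

section \<open>Rigidity: no relabelling other than the identity fixes a labelled object\<close>

lemma connected_points:
  assumes "nc S = 1" "p \<in> P" "q \<in> P"
  shows "(p, q) \<in> conn (comp_rel M S)"
proof -
  let ?E = "conn (comp_rel M S) \<inter> P \<times> P"
  obtain C where "P // ?E = {C}"
    using card_1_singletonE[OF assms(1)[unfolded num_classes_conn]] by blast
  moreover have "?E `` {p} \<in> P // ?E" "?E `` {q} \<in> P // ?E"
    using assms(2,3) by (auto intro: quotientI)
  ultimately have "?E `` {p} = ?E `` {q}" by simp
  then show ?thesis
    using eq_equiv_class_iff[OF equiv_conn assms(2,3)] by blast
qed

lemma move_commute:
  assumes "bij f" "move f M = M"
  shows "f (opp M x) = opp M (f x)" "f (wcor M x) = wcor M (f x)" "f (bcor M x) = bcor M (f x)"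
proof -
  have "opp M (f x) = opp (move f M) (f x)" "wcor M (f x) = wcor (move f M) (f x)"
    "bcor M (f x) = bcor (move f M) (f x)"
    by (simp_all only: assms(2))
  then show "f (opp M x) = opp M (f x)" "f (wcor M x) = wcor M (f x)" "f (bcor M x) = bcor M (f x)"
    using bij_is_inj[OF assms(1)] by (simp_all add: inv_f_f)
qed

text \<open>An automorphism commutes with \<open>opp\<close>, \<open>wcor\<close> and
  \<open>bcor\<close>, so its fixed sides are closed under these; by connectedness one fixed side
  forces all.\<close>

lemma rooted_free:
  assumes "nc S = 1" "root \<in> S" "f permutes S" "move f M = M" "f root = root"
  shows "f = id"
proof
  fix x
  note comm = move_commute[OF permutes_bij[OF assms(3)] assms(4)]
  have inv: "opp M (opp M y) = y" "wcor M (wcor M y) = y" "bcor M (bcor M y) = y" if "y \<in> S" for y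
    using that inv_opp inv_wcor inv_bcor by (auto simp: fpf_involution_on_def)
  have key: "f y = y \<longleftrightarrow> f (h y) = h y" if "\<And>x. f (h x) = h (f x)" "h (h y) = y" for h y
    using that by metis
  have adj: "f (fst p) = fst p \<longleftrightarrow> f (fst q) = fst q" if pq: "(p, q) \<in> comp_rel M S" for p q
  proof -
    have "fst p \<in> S \<and> fst q \<in> {fst p, opp M (fst p), wcor M (fst p), bcor M (fst p)}"
      using pq by (auto simp: comp_rel_def corner_arcs_def ribbon_sides_def attaching_arcs_def)
    then show ?thesis
      using key[OF comm(1) inv(1), of "fst p"] key[OF comm(2) inv(2), of "fst p"]
        key[OF comm(3) inv(3), of "fst p"] by (elim conjE insertE emptyE) simp_all
  qed
  show "f x = id x"
  proof (cases "x \<in> S")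
    case True
    then have "((root, White), (x, White)) \<in> conn (comp_rel M S)"
      using assms(1,2) by (intro connected_points) (auto simp: points_def)
    then have "f (fst (x, White)) = fst (x, White)"
      unfolding conn_def
    proof induction
      case base
      then show ?case using assms(5) by simp
    next
      case (step y z)
      then show ?case using adj by blast
    qed
    then show ?thesis by simp
  next
    case False
    then show ?thesis using assms(3) by (simp add: permutes_def)
  qed
qed

text \<open>Preserving the order means preserving ranks, so every edge is mapped to itself; its two
  sides cannot be exchanged because exactly one of them lies in \<open>L\<close>.\<close>

lemma ordered_oriented_free:
  assumes "is_orientation M L" "linear_order_on (edges M) r" "f permutes S"
    "move f M = M" "f ` L = L" "move_order f r = r"
  shows "f = id"
proof
  fix x
  have bij: "bij f" using assms(3) by (rule permutes_bij)
  let ?rk = "\<lambda>a. card {b \<in> edges M. (b, a) \<in> r}"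
  have E: "(`) f ` edges M = edges M"
    using edges_move[OF bij, of M] assms(4) by simp
  have rk: "?rk (f ` a) = ?rk a" for a
  proof -
    have "{b \<in> edges M. (b, f ` a) \<in> r} = (`) f ` {b \<in> edges M. (b, a) \<in> r}"
    proof -
      have "(f ` b, f ` a) \<in> r \<longleftrightarrow> (b, a) \<in> r" for b
        using move_order_iff[OF bij, of b a r] assms(6) by simp
      then have "(`) f ` {b \<in> edges M. (b, a) \<in> r} = {b \<in> (`) f ` edges M. (b, f ` a) \<in> r}"
        by auto
      then show ?thesis unfolding E by simp
    qed
    moreover have "inj_on ((`) f) {b \<in> edges M. (b, a) \<in> r}"
      using bij_is_inj[OF bij] by (auto simp: inj_on_def inj_image_eq_iff)
    ultimately show ?thesis by (simp add: card_image)
  qed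
  have inj: "inj_on ?rk (edges M)"
    using linear_order_rank[OF finite_edges assms(2)] by (rule bij_betw_imp_inj_on)
  have fix_edge: "f ` a = a" if a: "a \<in> edges M" for a
  proof (rule inj_onD[OF inj rk _ a])
    show "f ` a \<in> edges M" using imageI[OF a, of "(`) f"] unfolding E .
  qed
  show "f x = id x"
  proof (cases "x \<in> S")
    case True
    then have "f ` {x, opp M x} = {x, opp M x}"
      by (intro fix_edge) (auto simp: edges_def)
    then have "f x \<in> {x, opp M x}" by blast
    moreover have "f x \<noteq> opp M x"
    proof
      assume eq: "f x = opp M x"
      have "f x \<in> L \<longleftrightarrow> x \<in> L"
        using inj_image_mem_iff[OF bij_is_inj[OF bij], of x L] assms(5) by simp
      then show False
        using eq assms(1) True by (simp add: is_orientation_def)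
    qed
    ultimately show ?thesis by simp
  next
    case False
    then show ?thesis using assms(3) by (simp add: permutes_def)
  qed
qed

end

section \<open>From labelled objects to isomorphism classes\<close>

lemma finite_nonoriented_labelled: "finite (nonoriented_labelled n)"
proof (rule finite_surj)
  show "finite (maps n \<times> {..<2 * n})" using finite_maps by simp
  show "nonoriented_labelled n \<subseteq> (\<lambda>((M, r), root). (M, root, r)) ` (maps n \<times> {..<2 * n})"
  proof (rule subsetI)
    fix p assume p: "p \<in> nonoriented_labelled n"
    obtain M root r where [simp]: "p = (M, root, r)" by (cases p)
    show "p \<in> (\<lambda>((M, r), root). (M, root, r)) ` (maps n \<times> {..<2 * n})"
      by (rule image_eqI[where x = "((M, r), root)"])
        (use p in \<open>auto simp: nonoriented_labelled_def maps_def\<close>)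
  qed
qed

lemma finite_oriented_labelled: "finite (oriented_labelled n)"
proof (rule finite_surj)
  show "finite (maps n \<times> Pow {..<2 * n} \<times> Pow {..<2 * n})" using finite_maps by simp
  show "oriented_labelled n \<subseteq> (\<lambda>((M, r), L, root). (M, L, root, r)) ` (maps n \<times> Pow {..<2 * n} \<times> Pow {..<2 * n})"
  proof (rule subsetI)
    fix p assume p: "p \<in> oriented_labelled n"
    obtain M L root r where [simp]: "p = (M, L, root, r)" by (cases p)
    have *: "is_map M" "sides M = {..<2 * n}" "is_orientation M L" "root \<in> edges M" "linear_order_on (edges M) r"
      using p by (simp_all add: oriented_labelled_def)
    then have "root \<subseteq> {..<2 * n}" "L \<subseteq> {..<2 * n}"
      using ribbon_graph.Union_edges_all[of M] by (auto simp: is_map_iff is_orientation_def)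
    then show "p \<in> (\<lambda>((M, r), L, root). (M, L, root, r)) ` (maps n \<times> Pow {..<2 * n} \<times> Pow {..<2 * n})"
      using * by (intro image_eqI[where x = "((M, r), L, root)"]) (simp_all add: maps_def)
  qed
qed

definition act_nonoriented :: "(nat \<Rightarrow> nat) \<Rightarrow> nonoriented_ordered \<Rightarrow> nonoriented_ordered" where
  "act_nonoriented f = (\<lambda>(M, root, r). (move f M, f root, move_order f r))"

definition act_oriented :: "(nat \<Rightarrow> nat) \<Rightarrow> oriented_ordered \<Rightarrow> oriented_ordered" where
  "act_oriented f = (\<lambda>(M, L, root, r). (move f M, f ` L, f ` root, move_order f r))"

text \<open>Isomorphism is the orbit relation of the permutations of the \<open>2 * n\<close> sides,
  and this action is free by \<open>rooted_free\<close>; each class therefore has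
  \<open>fact (2 * n)\<close> labelled members.\<close>

lemma card_S1: "fact (2 * n) * card (S1 n) = card (nonoriented_labelled n)"
proof -
  let ?X = "nonoriented_labelled n" and ?S = "{..<2 * n}"
  have rg: "ribbon_graph M" "sides M = ?S" "root \<in> ?S" "linear_order_on (edges M) r" "is_map M"
    "num_classes (points M) (comp_rel M (sides M)) = 1" "num_faces M = 1"
    "\<And>i. 1 \<le> i \<Longrightarrow> i < n \<Longrightarrow>
       num_components_without M (first_edges M r i) = num_faces_without M (first_edges M r i)"
    if "(M, root, r) \<in> ?X" for M root r
    using that unfolding nonoriented_labelled_def mem_Collect_eq prod.case by (auto simp only: is_map_iff)
  have closed: "act_nonoriented f p \<in> ?X" if p: "p \<in> ?X" and f: "f permutes ?S" for p f
  proof -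
    obtain M root r where [simp]: "p = (M, root, r)" by (cases p)
    note M = rg[OF p[simplified]]
    interpret ribbon_graph M by (rule M(1))
    have bij: "bij f" using f by (rule permutes_bij)
    have F: "first_edges M r i \<subseteq> edges M" for i by (auto simp: first_edges_def)
    have "num_faces (move f M) = 1"
      using num_without_move(1)[OF bij, of "{}"] M(7) by simp
    moreover have "num_components_without (move f M) (first_edges (move f M) (move_order f r) i)
      = num_faces_without (move f M) (first_edges (move f M) (move_order f r) i)" if "1 \<le> i" "i < n" for i
      using M(8)[OF that] by (simp only: first_edges_move[OF bij] num_without_move[OF bij F])
    moreover have "f ` ?S = ?S" "f root \<in> ?S"
      using permutes_image[OF f] permutes_in_image[OF f] M(3) by auto
    ultimately show ?thesis
      using is_map_move[OF bij M(5)] linear_order_move[OF bij M(4)] M(2)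
      by (simp add: act_nonoriented_def nonoriented_labelled_def)
  qed
  have free: "f = id" if p: "p \<in> ?X" and f: "f permutes ?S" and eq: "act_nonoriented f p = p" for p f
  proof -
    obtain M root r where [simp]: "p = (M, root, r)" by (cases p)
    note M = rg[OF p[simplified]]
    interpret ribbon_graph M by (rule M(1))
    show ?thesis
      using rooted_free[of root f] M(2,3,6) f eq by (simp add: act_nonoriented_def)
  qed
  have iso: "nonoriented_iso p q \<longleftrightarrow> (\<exists>f. f permutes ?S \<and> q = act_nonoriented f p)"
    if p: "p \<in> ?X" and q: "q \<in> ?X" for p q
  proof -
    obtain M root r where [simp]: "p = (M, root, r)" by (cases p)
    obtain M' root' r' where [simp]: "q = (M', root', r')" by (cases q)
    note M = rg[OF p[simplified]] and M' = rg[OF q[simplified]]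
    interpret ribbon_graph M by (rule M(1))
    show ?thesis
    proof
      assume "nonoriented_iso p q"
      then obtain f where f: "map_iso M M' f" "f root = root'" "order_iso M r r' f"
        by (auto simp: nonoriented_iso_def)
      obtain g where g: "g permutes sides M" "\<And>x. x \<in> sides M \<Longrightarrow> g x = f x" "M' = move g M" "r' = move_order g r"
        using map_iso_imp_move[OF M'(1) _ f(1,3) M(4) M'(4)] M(2) M'(2) by metis
      then show "\<exists>f. f permutes ?S \<and> q = act_nonoriented f p"
        using M(2,3) f(2) by (intro exI[of _ g]) (simp add: act_nonoriented_def)
    next
      assume "\<exists>f. f permutes ?S \<and> q = act_nonoriented f p"
      then obtain f where f: "bij f" "q = act_nonoriented f p" using permutes_bij by blast
      then show "nonoriented_iso p q"
        using map_iso_move[OF f(1)] order_iso_move[OF f(1)]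
        by (auto simp: nonoriented_iso_def act_nonoriented_def)
    qed
  qed
  have "S1 n = ?X // {(p, q). p \<in> ?X \<and> q \<in> ?X \<and> (\<exists>f. f permutes ?S \<and> q = act_nonoriented f p)}"
    unfolding S1_def by (rule arg_cong[where f = "(//) ?X"]) (use iso in blast)
  moreover have "fact (card ?S) * card \<dots> = card ?X"
  proof (rule card_free_action)
    show "act_nonoriented id p = p" for p
      by (cases p) (simp add: act_nonoriented_def move_id move_order_id)
    show "act_nonoriented (f \<circ> g) p = act_nonoriented f (act_nonoriented g p)"
      if "f permutes ?S" "g permutes ?S" for p f g
      using move_comp[OF that[THEN permutes_bij]]
      by (cases p) (simp add: act_nonoriented_def move_order_comp)
  qed (use finite_nonoriented_labelled closed free in auto)
  ultimately show ?thesis by simp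
qed

lemma card_S2: "fact (2 * n) * card (S2 n) = card (oriented_labelled n)"
proof -
  let ?X = "oriented_labelled n" and ?S = "{..<2 * n}"
  have rg: "ribbon_graph M" "sides M = ?S" "root \<in> edges M" "linear_order_on (edges M) r" "is_map M"
    "is_orientation M L" if "(M, L, root, r) \<in> ?X" for M L root r
    using that unfolding oriented_labelled_def mem_Collect_eq prod.case is_map_iff by blast+
  have closed: "act_oriented f p \<in> ?X" if p: "p \<in> ?X" and f: "f permutes ?S" for p f
  proof -
    obtain M L root r where [simp]: "p = (M, L, root, r)" by (cases p)
    note M = rg[OF p[simplified]]
    interpret ribbon_graph M by (rule M(1))
    have bij: "bij f" using f by (rule permutes_bij)
    have "f ` root \<in> edges (move f M)"
      using M(3) by (simp add: edges_move[OF bij])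
    then show ?thesis
      using is_map_move[OF bij M(5)] linear_order_move[OF bij M(4)] orientation_move[OF bij M(6)]
        M(2) permutes_image[OF f]
      by (simp add: act_oriented_def oriented_labelled_def)
  qed
  have free: "f = id" if p: "p \<in> ?X" and f: "f permutes ?S" and eq: "act_oriented f p = p" for p f
  proof -
    obtain M L root r where [simp]: "p = (M, L, root, r)" by (cases p)
    note M = rg[OF p[simplified]]
    interpret ribbon_graph M by (rule M(1))
    show ?thesis
      using ordered_oriented_free[of L r f] M f eq by (simp add: act_oriented_def)
  qed
  have iso: "oriented_iso p q \<longleftrightarrow> (\<exists>f. f permutes ?S \<and> q = act_oriented f p)"
    if p: "p \<in> ?X" and q: "q \<in> ?X" for p q
  proof -
    obtain M L root r where [simp]: "p = (M, L, root, r)" by (cases p)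
    obtain M' L' root' r' where [simp]: "q = (M', L', root', r')" by (cases q)
    note M = rg[OF p[simplified]] and M' = rg[OF q[simplified]]
    interpret ribbon_graph M by (rule M(1))
    show ?thesis
    proof
      assume "oriented_iso p q"
      then obtain f where f: "map_iso M M' f" "f ` L = L'" "f ` root = root'" "order_iso M r r' f"
        by (auto simp: oriented_iso_def)
      obtain g where g: "g permutes sides M" "\<And>x. x \<in> sides M \<Longrightarrow> g x = f x" "M' = move g M" "r' = move_order g r"
        using map_iso_imp_move[OF M'(1) _ f(1,4) M(4) M'(4)] M(2) M'(2) by metis
      have "g ` A = f ` A" if "A \<subseteq> sides M" for A
        using that g(2) by (intro image_cong) auto
      moreover have "L \<subseteq> sides M" "root \<subseteq> sides M"
        using M(3,6) Union_edges_all by (auto simp: is_orientation_def)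
      ultimately have "g ` L = L'" "g ` root = root'"
        using f(2,3) by auto
      then show "\<exists>f. f permutes ?S \<and> q = act_oriented f p"
        using g M(2) by (intro exI[of _ g]) (simp add: act_oriented_def)
    next
      assume "\<exists>f. f permutes ?S \<and> q = act_oriented f p"
      then obtain f where f: "bij f" "q = act_oriented f p" using permutes_bij by blast
      then show "oriented_iso p q"
        using map_iso_move[OF f(1)] order_iso_move[OF f(1)]
        by (auto simp: oriented_iso_def act_oriented_def)
    qed
  qed
  have "S2 n = ?X // {(p, q). p \<in> ?X \<and> q \<in> ?X \<and> (\<exists>f. f permutes ?S \<and> q = act_oriented f p)}"
    unfolding S2_def by (rule arg_cong[where f = "(//) ?X"]) (use iso in blast)
  moreover have "fact (card ?S) * card \<dots> = card ?X"
  proof (rule card_free_action)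
    show "act_oriented id p = p" for p
      by (cases p) (simp add: act_oriented_def move_id move_order_id)
    show "act_oriented (f \<circ> g) p = act_oriented f (act_oriented g p)"
      if "f permutes ?S" "g permutes ?S" for p f g
      using move_comp[OF that[THEN permutes_bij]]
      by (cases p) (simp add: act_oriented_def move_order_comp image_comp)
  qed (use finite_oriented_labelled closed free in auto)
  ultimately show ?thesis by simp
qed

theorem theorem2p2:
  fixes n :: nat
  assumes "n \<ge> 1"
  shows "\<exists>\<Phi>. bij_betw \<Phi> (S1 n) (S2 n)"
proof (rule finite_same_card_bij)
  show "finite (S1 n)" "finite (S2 n)"
    unfolding S1_def S2_def
    by (rule finite_quotient; use finite_nonoriented_labelled finite_oriented_labelled in auto)+
  \<comment> \<open>Both kinds of classes have the same size, so equal numbers of labelled objects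
    give equal numbers of classes.\<close>
  have "fact (2 * n) * card (S1 n) = fact (2 * n) * card (S2 n)"
    by (simp only: card_S1 card_S2 card_nonoriented_oriented)
  then show "card (S1 n) = card (S2 n)" by simp
qed

end
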